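(* Let $\Phi \in C(\mathbb{R}) \cap L^1(\mathbb{R})$ be a real-valued positive-definite function and let $H(\mathbb{R})$ be the reproducing kernel Hilbert space of the translation-invariant kernel $K(x,y) = \Phi(x-y)$ on $\mathbb{R}$. Suppose that $\mathcal{F}\Phi(\xi) = O(e^{-\omega(\xi)})$, i.e. there is a constant $C>0$ with $\mathcal{F}\Phi(\xi) \leq C e^{-\omega(\xi)}$ for all $\xi \in \mathbb{R}$, for a (measurable) function $\omega \colon \mathbb{R} \to [0,\infty)$ such that $$\int_{\mathbb{R}} \frac{\omega(\xi)}{1+\xi^2}\, d\xi = \infty.$$ If $f \in H(\mathbb{R})$ has semibounded support, then $f \equiv 0$.
   Context: A function $\Phi \colon \mathbb{R} \to \mathbb{R}$ is positive-definite if the kernel $K(x,y)=\Phi(x-y)$ is symmetric and $\sum_{i,j=1}^n c_i c_j \Phi(y_i-y_j) > 0$ for all $n$, all distinct $y_1,\ldots,y_n$ and all $(c_1,\ldots,c_n) \in \mathbb{R}^n \setminus \{0\}$. The reproducing kernel Hilbert space of $K$ is the unique Hilbert space of functions $f \colon \mathbb{R} \to \mathbb{R}$ containing every $K(\cdot,x)$ and satisfying $\langle f, K(\cdot,x)\rangle = f(x)$ for all $f$ and $x$. The Fourier transform is $\mathcal{F}\Phi(\xi) = (2\pi)^{-1/2}\int_{\mathbb{R}} \Phi(x) e^{-\mathrm{i}x\xi}\,dx$ (it is real and non-negative for such $\Phi$, and is called the spectral density). It is a known result that $H(\mathbb{R}) = \{ f \in C(\mathbb{R}) \cap L^2(\mathbb{R})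 : \int_{\mathbb{R}} |\mathcal{F}f(\xi)|^2 / \mathcal{F}\Phi(\xi)\, d\xi < \infty \}$. A function $f \colon \mathbb{R} \to \mathbb{R}$ has semibounded support if there is $a \in \mathbb{R}$ such that $\operatorname{supp}(f) \subseteq (-\infty,a]$ or $\operatorname{supp}(f) \subseteq [a,\infty)$, where $\operatorname{supp}(f)$ is the closure of $\{f \neq 0\}$. *)

theory Defs
  imports "HOL-Analysis.Analysis"
begin

definition positive_definite_function :: "(real \<Rightarrow> real) \<Rightarrow> bool" where
  "positive_definite_function \<Phi> \<longleftrightarrow>
     (\<forall>x y. \<Phi> (x - y) = \<Phi> (y - x)) \<and>
     (\<forall>(n::nat) (y::nat \<Rightarrow> real) (c::nat \<Rightarrow> real).
        inj_on y {..<n} \<longrightarrow> (\<exists>i<n. c i \<noteq> 0) \<longrightarrow>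
        (\<Sum>i<n. \<Sum>j<n. c i * c j * \<Phi> (y i - y j)) > 0)"

text \<open>
  The inner product \<open>ip\<close> is only constrained on \<open>H\<close>; its values elsewhere are irrelevant.
\<close>
locale hilbert_function_space =
  fixes H :: "('a \<Rightarrow> real) set"
    and ip :: "('a \<Rightarrow> real) \<Rightarrow> ('a \<Rightarrow> real) \<Rightarrow> real"
  assumes zero_mem: "(\<lambda>x. 0) \<in> H"
    and add_mem: "\<lbrakk>f \<in> H; g \<in> H\<rbrakk> \<Longrightarrow> (\<lambda>x. f x + g x) \<in> H"
    and scale_mem: "f \<in> H \<Longrightarrow> (\<lambda>x. r * f x) \<in> H"
    and ip_commute: "\<lbrakk>f \<in> H; g \<in> H\<rbrakk> \<Longrightarrow> ip f g = ip g f"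
    and ip_add_left: "\<lbrakk>f \<in> H; g \<in> H; h \<in> H\<rbrakk> \<Longrightarrow> ip (\<lambda>x. f x + g x) h = ip f h + ip g h"
    and ip_scale_left: "\<lbrakk>f \<in> H; g \<in> H\<rbrakk> \<Longrightarrow> ip (\<lambda>x. r * f x) g = r * ip f g"
    and ip_nonneg: "f \<in> H \<Longrightarrow> 0 \<le> ip f f"
    and ip_eq_zero: "\<lbrakk>f \<in> H; ip f f = 0\<rbrakk> \<Longrightarrow> f = (\<lambda>x. 0)"
    and complete: "\<And>u :: nat \<Rightarrow> 'a \<Rightarrow> real.
      \<lbrakk>\<And>n. u n \<in> H;
       \<forall>e>0. \<exists>N. \<forall>m\<ge>N. \<forall>n\<ge>N.
         sqrt (ip (\<lambda>x. u m x - u n x) (\<lambda>x. u m x - u n x)) < e\<rbrakk>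
      \<Longrightarrow> \<exists>f\<in>H. (\<lambda>n. sqrt (ip (\<lambda>x. u n x - f x) (\<lambda>x. u n x - f x))) \<longlonglongrightarrow> 0"

text \<open>
  For each kernel \<open>K\<close> there is at most one pair of a set \<open>H\<close> and an inner product on \<open>H\<close>
  satisfying this predicate, so assuming it identifies \<open>H\<close> as the reproducing kernel
  Hilbert space of \<open>K\<close>.
\<close>
locale reproducing_kernel_hilbert_space = hilbert_function_space H ip
  for K :: "'a \<Rightarrow> 'a \<Rightarrow> real"
    and H :: "('a \<Rightarrow> real) set"
    and ip :: "('a \<Rightarrow> real) \<Rightarrow> ('a \<Rightarrow> real) \<Rightarrow> real" +
  assumes kernel_mem: "(\<lambda>y. K y x) \<in> H"
    and reproducing: "f \<in> H \<Longrightarrow> ip f (\<lambda>y. K y x) = f x"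

definition fourier_transform :: "(real \<Rightarrow> real) \<Rightarrow> real \<Rightarrow> complex" where
  "fourier_transform f \<xi> =
     complex_of_real (1 / sqrt (2 * pi)) *
     (LINT x|lebesgue. complex_of_real (f x) * exp (- (\<i> * complex_of_real (x * \<xi>))))"

definition support :: "('a::topological_space \<Rightarrow> real) \<Rightarrow> 'a set" where
  "support f = closure {x. f x \<noteq> 0}"

definition semibounded_support :: "(real \<Rightarrow> real) \<Rightarrow> bool" where
  "semibounded_support f \<longleftrightarrow> (\<exists>a. support f \<subseteq> {..a} \<or> support f \<subseteq> {a..})"

end

theory Submission
  imports Defs "HOL-Probability.Sinc_Integral"
begin

text \<open>
  By Cauchy-Schwarz in $H$, with $M = \|f\|^2$,
  $(\int c f)^2 \le M \iint c(x) c(y) \Phi(x-y) \le \frac{M}{2\pi} \int |\hat c|^2 W$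
  for every real integrable $c$, where $W$ is the positive part of $\hat\Phi$. This bound survives
  translations and reflections of $f$, so we may assume that $f$ vanishes on $[0,\infty)$.
  Let $u$ be even and $k = \frac{1}{2\pi} \hat u$ on $(0,\infty)$, so that $2 \mathrm{Re}\, \hat k = u$.
  Since $f$ vanishes on $[0,\infty)$, convolving $e^{\lambda x} 1_{x<0}$ with $k$ multiplies its pairing with
  $f$ by $K = \int_0^\infty k(y) e^{-\lambda y} dy = \frac{1}{2\pi} \int u \lambda / (\lambda^2 + \xi^2)$.
  The convolution exponential of $k$ thus yields
  $2 \pi (e^K \int_{x<0} e^{\lambda x} f)^2 \le M \int e^u W / (\lambda^2 + \xi^2)$.
  Letting $u$ increase to $\omega$, the right side stays bounded and $K \to \infty$. Hence all
  exponential moments of $f$ vanish, and $f = 0$ by Weierstrass approximation in $e^x$. This replaces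
  the log-integral theorem for Hardy functions: $e^{\hat k}$ plays the role of an outer function.
\<close>

subsection \<open>Exponentials and bounded kernels\<close>

text \<open>The exponential is what separates the two sides. Convolution powers of \<open>k\<close>
  act on the spectral side through powers of its transform, so their exponential series produces the
  weight |exp z|^2 = exp (2 Re z) = e^u, while on the pairing it produces e^K. As long as u \<le>
  \<omega>, the factor e^u is cancelled by the decay of W, and the right side is at most a constant
  multiple of the integral of 1 / (\<lambda>^2 + \<xi>^2); all growth is left to K. The obstacle is
  that cutting the transform of a general u to a half-line need not give an integrable
  \<open>k\<close>. The transform is therefore damped by \<open>exp (- (e * \<bar>y\<bar>))\<close>,
  at an exactly computable price: u turns into its Poisson mean at scale \<open>e\<close>, and the
  rate \<lambda> in K turns into \<lambda> + \<open>e\<close>. The damping is removed for continuous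
  u, continuity is traded for measurability by limits almost everywhere, and only then are
  truncations of \<omega> inserted. Taking u even costs nothing, because the transform of \<Phi> is
  even and \<omega> can be replaced by the maximum of \<omega> and its reflection.\<close>

lemma borel_measurable_cis [measurable]: "cis \<in> borel_measurable borel"
  by (intro borel_measurable_continuous_onI continuous_on_cis continuous_on_id)

lemma integrable_scaleR_bounded:
  fixes a :: "real \<Rightarrow> real" and h :: "real \<Rightarrow> 'a::{banach, second_countable_topology}"
  assumes a: "integrable lborel a" and h[measurable]: "h \<in> borel_measurable borel"
    and bound: "\<And>x. norm (h x) \<le> B"
  shows "integrable lborel (\<lambda>x. a x *\<^sub>R h x)"
proof (rule Bochner_Integration.integrable_bound)
  show "integrable lborel (\<lambda>x. a x * B)" using a by simp
  have [measurable]: "a \<in> borel_measurable borel" using a by auto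
  show "(\<lambda>x. a x *\<^sub>R h x) \<in> borel_measurable lborel" by simp
  show "AE x in lborel. norm (a x *\<^sub>R h x) \<le> norm (a x * B)"
    using bound by (auto simp: abs_mult intro!: mult_left_mono order_trans[OF bound])
qed

lemmas integrable_mult_bounded = integrable_scaleR_bounded[where 'a = real, unfolded real_scaleR_def]

text \<open>In this sign convention the value is 1 / (l - i \<xi>). The reflected exponential, on
  the negative half-line, has transform 1 / (l + i \<xi>), whose squared modulus is the factor 1 /
  (l^2 + \<xi>^2) of the final estimate.\<close>

lemma one_sided_exponential:
  fixes l \<xi> :: real
  assumes "0 < l"
  shows integrable_one_sided_exponential:
      "integrable lborel (\<lambda>x. indicator {0<..} x * exp (- (l * x)))"
    and integral_one_sided_exponential:
      "(LINT x|lborel. (indicator {0<..} x * exp (- (l * x))) *\<^sub>R cis (x * \<xi>)) = 1 / Complex l (- \<xi>)"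
proof -
  define z where "z = Complex l (- \<xi>)"
  have z0: "z \<noteq> 0" using assms by (auto simp: z_def complex_eq_iff)
  define F where "F x = - exp (- (of_real x * z)) / z" for x
  have f_eq: "exp (- (l * x)) *\<^sub>R cis (x * \<xi>) = exp (- (of_real x * z))" for x
    by (simp add: z_def exp_eq_polar scaleR_conv_of_real algebra_simps)
  show int: "integrable lborel (\<lambda>x. indicator {0<..} x * exp (- (l * x)))"
    using integrable_I0i_exp_mscale[OF assms] by (simp add: set_integrable_def mult.commute)
  have norm_lim: "((\<lambda>x. exp (- (l * x))) \<longlongrightarrow> 0) at_top"
    using assms by real_asymp
  have "(LBINT x=ereal 0..\<infinity>. exp (- (l * x)) *\<^sub>R cis (x * \<xi>)) = 0 - F 0"
  proof (rule interval_integral_FTC_integrable)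
    show "(F has_vector_derivative exp (- (l * x)) *\<^sub>R cis (x * \<xi>)) (at x)" for x
      unfolding F_def f_eq using z0
      by (auto intro!: derivative_eq_intros has_vector_derivative_real_field)
    show "isCont (\<lambda>x. exp (- (l * x)) *\<^sub>R cis (x * \<xi>)) x" for x
      unfolding cis_conv_exp by (auto intro!: continuous_intros)
    show "set_integrable lborel (einterval (ereal 0) \<infinity>) (\<lambda>x. exp (- (l * x)) *\<^sub>R cis (x * \<xi>))"
      unfolding set_integrable_def
      by (rule Bochner_Integration.integrable_bound[OF int]) (auto simp: indicator_def)
    have "isCont F 0" unfolding F_def by (auto intro!: continuous_intros z0)
    then show "((F \<circ> real_of_ereal) \<longlongrightarrow> F 0) (at_right (ereal 0))"
      unfolding ereal_tendsto_simps1 isCont_def by (simp add: filterlim_at_split)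
    have "((\<lambda>x. norm (F x)) \<longlongrightarrow> 0 / norm z) at_top"
      unfolding F_def using z0
      by (simp add: norm_divide z_def) (intro tendsto_divide_zero norm_lim[unfolded mult.commute[of l]])
    then show "((F \<circ> real_of_ereal) \<longlongrightarrow> 0) (at_left \<infinity>)"
      unfolding ereal_tendsto_simps1 by (simp add: tendsto_norm_zero_iff)
  qed auto
  then show "(LINT x|lborel. (indicator {0<..} x * exp (- (l * x))) *\<^sub>R cis (x * \<xi>)) = 1 / Complex l (- \<xi>)"
    by (simp add: interval_lebesgue_integral_def set_lebesgue_integral_def F_def z_def
        flip: scaleR_scaleR)
qed

lemma integral_even:
  fixes g :: "real \<Rightarrow> real"
  assumes g: "integrable lborel g" and even: "\<And>x. g (- x) = g x"
  shows "(LINT x|lborel. g x) = 2 * (LINT x|lborel. indicator {0<..} x * g x)"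
proof -
  have i: "integrable lborel (\<lambda>x. indicator A x * g x)" if "A \<in> sets borel" for A
    using integrable_mult_indicator[of A lborel g] g that by simp
  have "(LINT x|lborel. g x)
      = (LINT x|lborel. indicator {0<..} x * g x + indicator {..<0} x * g x)"
    using g by (intro integral_cong_AE) (use AE_lborel_singleton[of 0] in \<open>auto simp: indicator_def\<close>)
  also have "\<dots> = (LINT x|lborel. indicator {0<..} x * g x) + (LINT x|lborel. indicator {..<0} x * g x)"
    by (intro Bochner_Integration.integral_add i) auto
  also have "(LINT x|lborel. indicator {..<0} x * g x) = (LINT x|lborel. indicator {0<..} x * g x)"
    by (subst lborel_integral_real_affine[of "-1" _ 0]) (auto simp: even indicator_def)
  finally show ?thesis by simp
qed

lemma integrable_two_sided_exponential:
  fixes l :: real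
  assumes "0 < l"
  shows "integrable lborel (\<lambda>x. exp (- (l * \<bar>x\<bar>)))"
proof -
  note i = integrable_one_sided_exponential[OF assms]
  have j: "integrable lborel (\<lambda>x. indicator {0<..} (-x) * exp (- (l * (- x))))"
    using lborel_integrable_real_affine[OF i, of "-1" 0] by simp
  have "integrable lborel (\<lambda>x. indicator {0<..} x * exp (- (l * x)) + indicator {0<..} (-x) * exp (- (l * (- x))))"
    by (intro Bochner_Integration.integrable_add i j)
  then show ?thesis
    by (rule integrable_cong_AE_imp) (use AE_lborel_singleton[of 0] in \<open>auto simp: indicator_def\<close>)
qed

text \<open>The Poisson kernel of the half-plane enters here. It is used with the small rate
  \<open>e\<close> for the Abel means and with the rate \<open>l + e\<close> for the value of
  K.\<close>

lemma integral_two_sided_exponential: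
  fixes l \<xi> :: real
  assumes "0 < l"
  shows "(LINT x|lborel. exp (- (l * \<bar>x\<bar>)) * cos (x * \<xi>)) = 2 * l / (l\<^sup>2 + \<xi>\<^sup>2)"
proof -
  have i: "integrable lborel (\<lambda>x. exp (- (l * \<bar>x\<bar>)) * cos (x * \<xi>))"
    by (rule Bochner_Integration.integrable_bound[OF integrable_two_sided_exponential[OF assms]])
       (auto simp: abs_mult)
  have j: "integrable lborel (\<lambda>x. (indicator {0<..} x * exp (- (l * x))) *\<^sub>R cis (x * \<xi>))"
    by (rule integrable_scaleR_bounded[OF integrable_one_sided_exponential[OF assms], of _ 1]) auto
  have "(LINT x|lborel. exp (- (l * \<bar>x\<bar>)) * cos (x * \<xi>))
      = 2 * (LINT x|lborel. indicator {0<..} x * (exp (- (l * \<bar>x\<bar>)) * cos (x * \<xi>)))"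
    by (rule integral_even[OF i]) simp
  also have "(LINT x|lborel. indicator {0<..} x * (exp (- (l * \<bar>x\<bar>)) * cos (x * \<xi>)))
      = (LINT x|lborel. Re ((indicator {0<..} x * exp (- (l * x))) *\<^sub>R cis (x * \<xi>)))"
    by (rule Bochner_Integration.integral_cong) (auto simp: indicator_def)
  also have "\<dots> = Re (1 / Complex l (- \<xi>))"
    using integral_Re[OF j] integral_one_sided_exponential[OF assms] by simp
  finally show ?thesis by (simp add: Re_divide power2_eq_square)
qed

text \<open>Up to the factor \<open>B\<close>, the product of \<open>a\<close> and \<open>b\<close>
  dominates the integrand. The kernels fed in below are cosines, products of two cosines, and
  integrals of cosines against an integrable function.\<close>

lemma Fubini_bounded_kernel:
  fixes a b :: "real \<Rightarrow> real" and q :: "real \<Rightarrow> real \<Rightarrow> 'a::{banach, second_countable_topology}"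
  assumes a[measurable]: "integrable lborel a" and b[measurable]: "integrable lborel b"
    and q[measurable]: "(\<lambda>(x, y). q x y) \<in> borel_measurable (lborel \<Otimes>\<^sub>M lborel)"
    and bound: "\<And>x y. norm (q x y) \<le> B"
  shows "(LINT x|lborel. a x *\<^sub>R (LINT y|lborel. b y *\<^sub>R q x y))
       = (LINT y|lborel. b y *\<^sub>R (LINT x|lborel. a x *\<^sub>R q x y))"
proof -
  have "integrable (lborel \<Otimes>\<^sub>M lborel) (\<lambda>p. a (fst p) * b (snd p))"
    using a b
    by (intro lborel_pair.Fubini_integrable) (auto simp: abs_mult)
  then have "integrable (lborel \<Otimes>\<^sub>M lborel) (\<lambda>p. a (fst p) * b (snd p) * B)"
    by simp
  then have "integrable (lborel \<Otimes>\<^sub>M lborel) (\<lambda>(x, y). (a x * b y) *\<^sub>R q x y)"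
  proof (rule Bochner_Integration.integrable_bound)
    show "(\<lambda>(x, y). (a x * b y) *\<^sub>R q x y) \<in> borel_measurable (lborel \<Otimes>\<^sub>M lborel)"
      by measurable
    have "norm (q x y) \<le> \<bar>B\<bar>" for x y using bound[of x y] by simp
    then show "AE p in lborel \<Otimes>\<^sub>M lborel. norm (case p of (x, y) \<Rightarrow> (a x * b y) *\<^sub>R q x y)
        \<le> norm (a (fst p) * b (snd p) * B)"
      by (intro AE_I2) (auto simp: abs_mult split: prod.split intro!: mult_left_mono)
  qed
  from lborel_pair.Fubini_integral[OF this] show ?thesis
    by (simp add: mult.commute flip: scaleR_scaleR integral_scaleR_right) (simp add: ac_simps)
qed

subsection \<open>Convolution and Poisson means\<close>

text \<open>Testing against an arbitrary bounded \<open>g\<close> serves two purposes: a character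
  gives multiplicativity of the Fourier integral, and a translate of \<open>f\<close> gives the
  pairing of a convolution with \<open>f\<close>.\<close>

lemma convolution_L1:
  fixes a b :: "real \<Rightarrow> real"
  assumes a: "integrable lborel a" and b: "integrable lborel b"
  defines "c \<equiv> \<lambda>x. LINT y|lborel. a y * b (x - y)"
  shows integrable_convolution: "integrable lborel c"
    and integral_convolution_scaleR: "\<And>g :: real \<Rightarrow> 'a::{banach, second_countable_topology}.
      \<lbrakk>g \<in> borel_measurable borel; \<And>x. norm (g x) \<le> B\<rbrakk> \<Longrightarrow>
      (LINT x|lborel. c x *\<^sub>R g x) = (LINT y|lborel. a y *\<^sub>R (LINT x|lborel. b x *\<^sub>R g (x + y)))"
proof -
  have [measurable]: "a \<in> borel_measurable borel" "b \<in> borel_measurable borel"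
    using a b by auto
  have sh: "integrable lborel (\<lambda>x. b (x - y))" for y
    using lborel_integrable_real_affine[OF b, of 1 "-y"] by simp
  have shift: "(LINT x|lborel. h (x - y)) = (LINT x|lborel. h x)" for h :: "real \<Rightarrow> 'b::{banach, second_countable_topology}" and y
    by (subst (2) lborel_integral_real_affine[of 1 _ "-y"]) auto
  have int: "integrable (lborel \<Otimes>\<^sub>M lborel) (\<lambda>(y, x). a y * b (x - y))"
  proof (rule lborel_pair.Fubini_integrable)
    have "(LINT x|lborel. norm (a y * b (x - y))) = \<bar>a y\<bar> * (LINT x|lborel. \<bar>b x\<bar>)" for y
      by (simp add: abs_mult shift[of "\<lambda>x. \<bar>b x\<bar>"])
    then show "integrable lborel (\<lambda>y. LINT x|lborel. norm (case (y, x) of (y, x) \<Rightarrow> a y * b (x - y)))"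
      using a by simp
  qed (use sh in auto)
  show "integrable lborel c"
    using lborel_pair.integrable_snd[OF int] by (simp add: c_def)
  fix g :: "real \<Rightarrow> 'a::{banach, second_countable_topology}"
  assume g[measurable]: "g \<in> borel_measurable borel" and bound: "\<And>x. norm (g x) \<le> B"
  have int2: "integrable (lborel \<Otimes>\<^sub>M lborel) (\<lambda>(y, x). (a y * b (x - y)) *\<^sub>R g x)"
  proof (rule Bochner_Integration.integrable_bound)
    show "integrable (lborel \<Otimes>\<^sub>M lborel) (\<lambda>p. (case p of (y, x) \<Rightarrow> a y * b (x - y)) * B)"
      using int by (rule integrable_mult_left)
    have "norm (g x) \<le> \<bar>B\<bar>" for x using bound[of x] by simp
    then show "AE p in lborel \<Otimes>\<^sub>M lborel. norm (case p of (y, x) \<Rightarrow> (a y * b (x - y)) *\<^sub>R g x)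
        \<le> norm ((case p of (y, x) \<Rightarrow> a y * b (x - y)) * B)"
      by (intro AE_I2) (auto simp: abs_mult split: prod.split intro!: mult_left_mono)
  qed measurable
  have "(LINT x|lborel. c x *\<^sub>R g x) = (LINT x|lborel. LINT y|lborel. (a y * b (x - y)) *\<^sub>R g x)"
    unfolding c_def
  proof (intro integral_cong_AE)
    \<comment> \<open>The inner integral is known to converge only for almost every
      \<open>x\<close>, so the factor \<open>g x\<close> is moved inside only almost
      everywhere.\<close>
    show "AE x in lborel. (LINT y|lborel. a y * b (x - y)) *\<^sub>R g x
        = (LINT y|lborel. (a y * b (x - y)) *\<^sub>R g x)"
      using lborel_pair.AE_integrable_snd[OF int]
      by eventually_elim (rule integral_scaleR_left[symmetric], auto)
  qed measurable
  also have "\<dots> = (LINT y|lborel. LINT x|lborel. (a y * b (x - y)) *\<^sub>R g x)"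
    using lborel_pair.Fubini_integral[OF int2] .
  also have "\<dots> = (LINT y|lborel. a y *\<^sub>R (LINT x|lborel. b x *\<^sub>R g (x + y)))"
    using shift[of "\<lambda>x. b x *\<^sub>R g (x + y)" y for y] by (simp flip: scaleR_scaleR)
  finally show "(LINT x|lborel. c x *\<^sub>R g x) = (LINT y|lborel. a y *\<^sub>R (LINT x|lborel. b x *\<^sub>R g (x + y)))" .
qed

text \<open>For even \<open>g\<close> this is the whole Fourier integral, kept real and without the
  factor \<open>1 / sqrt (2 * pi)\<close>; \<open>Re_fourier_transform\<close> restores the
  factor.\<close>

definition cosine_transform :: "(real \<Rightarrow> real) \<Rightarrow> real \<Rightarrow> real" where
  "cosine_transform g \<xi> = (LINT x|lborel. g x * cos (x * \<xi>))"

lemma borel_measurable_cosine_transform [measurable]: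
  assumes [measurable]: "g \<in> borel_measurable borel"
  shows "cosine_transform g \<in> borel_measurable borel"
  unfolding cosine_transform_def[abs_def] by measurable

lemma abs_cosine_transform_le:
  assumes g: "integrable lborel g"
  shows "\<bar>cosine_transform g \<xi>\<bar> \<le> (LINT x|lborel. \<bar>g x\<bar>)"
  unfolding cosine_transform_def
proof (rule Bochner_Integration.integral_abs_bound_integral)
  show "integrable lborel (\<lambda>x. g x * cos (x * \<xi>))"
    by (rule integrable_mult_bounded[OF g, of _ 1]) auto
qed (use g in \<open>auto simp: abs_mult intro!: mult_left_le\<close>)

lemma cosine_transform_minus: "cosine_transform g (- \<xi>) = cosine_transform g \<xi>"
  by (simp add: cosine_transform_def)

text \<open>Abel summation of the inverse transform: by Fubini the damped oscillation is integrated
  first and yields a Poisson kernel of width \<open>e\<close>. Rescaling moves \<open>e\<close> from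
  the kernel into the argument of \<open>g\<close>, so that letting \<open>e\<close> tend to 0 is
  dominated convergence against one fixed kernel. The mass 2 pi of that kernel is the constant of
  Fourier inversion.\<close>

lemma Poisson_mean:
  fixes g :: "real \<Rightarrow> real"
  assumes g: "integrable lborel g" and even: "\<And>x. g (- x) = g x" and e: "0 < e"
  shows "(LINT y|lborel. exp (- (e * \<bar>y\<bar>)) * (cosine_transform g y * cos (x * y)))
       = (LINT z|lborel. g (x + e * z) * (2 / (1 + z\<^sup>2)))"
proof -
  have [measurable]: "g \<in> borel_measurable borel" using g by auto
  note E = integrable_two_sided_exponential[OF e]
  let ?p = "\<lambda>s. e / (e\<^sup>2 + s\<^sup>2)"
  have p_bound: "norm (?p s) \<le> 1 / e" for s
  proof -
    have "0 < e\<^sup>2 + s\<^sup>2" using e by (simp add: add_pos_nonneg)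
    then show ?thesis using e by (simp add: divide_le_eq le_divide_eq power2_eq_square)
  qed
  have ker: "(LINT y|lborel. exp (- (e * \<bar>y\<bar>)) * (cos (t * y) * cos (x * y))) = ?p (t - x) + ?p (t + x)" for t
  proof -
    have "(LINT y|lborel. exp (- (e * \<bar>y\<bar>)) * (cos (t * y) * cos (x * y)))
        = (LINT y|lborel. (exp (- (e * \<bar>y\<bar>)) * cos (y * (t - x)) + exp (- (e * \<bar>y\<bar>)) * cos (y * (t + x))) / 2)"
      by (intro Bochner_Integration.integral_cong refl) (simp add: cos_times_cos algebra_simps)
    also have "\<dots> = (LINT y|lborel. exp (- (e * \<bar>y\<bar>)) * cos (y * (t - x)) + exp (- (e * \<bar>y\<bar>)) * cos (y * (t + x))) / 2"
      by (rule integral_divide_zero)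
    also have "\<dots> = ((LINT y|lborel. exp (- (e * \<bar>y\<bar>)) * cos (y * (t - x)))
         + (LINT y|lborel. exp (- (e * \<bar>y\<bar>)) * cos (y * (t + x)))) / 2"
      by (subst Bochner_Integration.integral_add) (auto intro!: integrable_mult_bounded[OF E, of _ 1])
    finally show ?thesis
      unfolding integral_two_sided_exponential[OF e] by simp
  qed
  have i1: "integrable lborel (\<lambda>t. g t * ?p (t - x))" and i2: "integrable lborel (\<lambda>t. g t * ?p (t + x))"
    by (intro integrable_mult_bounded[OF g, of _ "1 / e"] p_bound; measurable)+
  have "(LINT y|lborel. exp (- (e * \<bar>y\<bar>)) * (cosine_transform g y * cos (x * y)))
      = (LINT y|lborel. exp (- (e * \<bar>y\<bar>)) * (LINT t|lborel. g t * (cos (t * y) * cos (x * y))))"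
    by (simp add: cosine_transform_def flip: mult.assoc)
  also have "\<dots> = (LINT t|lborel. g t * (LINT y|lborel. exp (- (e * \<bar>y\<bar>)) * (cos (t * y) * cos (x * y))))"
    using Fubini_bounded_kernel[OF E g, of "\<lambda>y t. cos (t * y) * cos (x * y)" 1]
    by (simp add: abs_mult mult_le_one)
  also have "\<dots> = (LINT t|lborel. g t * ?p (t - x) + g t * ?p (t + x))"
    unfolding ker by (simp add: distrib_left)
  also have "\<dots> = (LINT t|lborel. g t * ?p (t - x)) + (LINT t|lborel. g t * ?p (t + x))"
    by (intro Bochner_Integration.integral_add i1 i2)
  \<comment> \<open>The product of two cosines produced a second kernel, centred at
    \<open>- x\<close>; evenness of \<open>g\<close> folds it onto the one centred at
    \<open>x\<close>.\<close>
  also have "(LINT t|lborel. g t * ?p (t + x)) = (LINT t|lborel. g t * ?p (t - x))"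
    by (subst lborel_integral_real_affine[of "-1" _ 0]) (auto simp: even power2_eq_square algebra_simps)
  also have "(LINT t|lborel. g t * ?p (t - x)) + (LINT t|lborel. g t * ?p (t - x))
      = (LINT t|lborel. 2 * (g t * ?p (t - x)))"
    by (subst integral_mult_right_zero) simp
  also have "\<dots> = e * (LINT z|lborel. 2 * (g (x + e * z) * ?p (e * z)))"
    using e by (subst lborel_integral_real_affine[of e _ x]) auto
  also have "\<dots> = (LINT z|lborel. e * (2 * (g (x + e * z) * ?p (e * z))))"
    by (rule integral_mult_right_zero[symmetric])
  also have "\<dots> = (LINT z|lborel. g (x + e * z) * (2 / (1 + z\<^sup>2)))"
  proof (intro Bochner_Integration.integral_cong refl)
    fix z :: real
    have "e\<^sup>2 + (e * z)\<^sup>2 = e * (e * (1 + z\<^sup>2))"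
      by (simp add: power2_eq_square algebra_simps)
    then show "e * (2 * (g (x + e * z) * ?p (e * z))) = g (x + e * z) * (2 / (1 + z\<^sup>2))"
      using e by simp
  qed
  finally show ?thesis .
qed

section \<open>Boundedness and convergence of Poisson means\<close>

lemma integrable_Cauchy_kernel: "integrable lborel (\<lambda>z::real. 2 / (1 + z\<^sup>2))"
  using integrable_inverse_1_plus_square
  by (simp add: set_integrable_def divide_inverse)

lemma integral_Cauchy_kernel: "(LINT z|lborel. 2 / (1 + z\<^sup>2)) = 2 * pi"
  using LBINT_inverse_1_plus_square
  by (simp add: interval_lebesgue_integral_def set_lebesgue_integral_def divide_inverse)

lemma abs_Poisson_mean_le:
  fixes g :: "real \<Rightarrow> real"
  assumes g: "g \<in> borel_measurable borel" and bound: "\<And>x. \<bar>g x\<bar> \<le> B"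
  shows "\<bar>LINT z|lborel. g (x + e * z) * (2 / (1 + z\<^sup>2))\<bar> \<le> 2 * pi * B"
proof -
  note [measurable] = g
  have "\<bar>LINT z|lborel. g (x + e * z) * (2 / (1 + z\<^sup>2))\<bar> \<le> (LINT z|lborel. B * (2 / (1 + z\<^sup>2)))"
  proof (rule Bochner_Integration.integral_abs_bound_integral)
    show "integrable lborel (\<lambda>z. g (x + e * z) * (2 / (1 + z\<^sup>2)))"
      using integrable_mult_bounded[OF integrable_Cauchy_kernel, of "\<lambda>z. g (x + e * z)" B] bound
      by (simp add: mult.commute)
    show "integrable lborel (\<lambda>z::real. B * (2 / (1 + z\<^sup>2)))"
      using integrable_Cauchy_kernel by (rule integrable_mult_right)
    show "\<bar>g (x + e * z) * (2 / (1 + z\<^sup>2))\<bar> \<le> B * (2 / (1 + z\<^sup>2))" for z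
      unfolding abs_mult using bound[of "x + e * z"] by (intro mult_mono) (auto simp: abs_of_nonneg)
  qed
  also have "\<dots> = 2 * pi * B" by (simp only: integral_mult_right_zero integral_Cauchy_kernel) simp
  finally show ?thesis .
qed

lemma Poisson_mean_tendsto:
  fixes g :: "real \<Rightarrow> real" and e :: "nat \<Rightarrow> real"
  assumes g: "continuous_on UNIV g" and bound: "\<And>x. \<bar>g x\<bar> \<le> B" and e: "e \<longlonglongrightarrow> 0"
  shows "(\<lambda>n. LINT z|lborel. g (x + e n * z) * (2 / (1 + z\<^sup>2))) \<longlonglongrightarrow> 2 * pi * g x"
proof -
  have [measurable]: "g \<in> borel_measurable borel" using g by (rule borel_measurable_continuous_onI)
  have "(\<lambda>n. LINT z|lborel. g (x + e n * z) * (2 / (1 + z\<^sup>2))) \<longlonglongrightarrow> (LINT z|lborel. g x * (2 / (1 + z\<^sup>2)))"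
  proof (rule integral_dominated_convergence)
    show "integrable lborel (\<lambda>z::real. B * (2 / (1 + z\<^sup>2)))"
      using integrable_Cauchy_kernel by (rule integrable_mult_right)
    have "(\<lambda>n. g (x + e n * z)) \<longlonglongrightarrow> g x" for z
    proof -
      have "(\<lambda>n. x + e n * z) \<longlonglongrightarrow> x + 0 * z" by (intro tendsto_intros e)
      then show ?thesis
        using isCont_tendsto_compose[of x g] g by (simp add: continuous_on_eq_continuous_at)
    qed
    then show "AE z in lborel. (\<lambda>n. g (x + e n * z) * (2 / (1 + z\<^sup>2))) \<longlonglongrightarrow> g x * (2 / (1 + z\<^sup>2))"
      by (intro AE_I2 tendsto_mult tendsto_const)
    show "AE z in lborel. norm (g (x + e n * z) * (2 / (1 + z\<^sup>2))) \<le> B * (2 / (1 + z\<^sup>2))" for n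
      unfolding norm_mult using bound by (intro AE_I2 mult_mono) (auto simp: abs_of_nonneg intro: order_trans[OF abs_ge_zero bound])
  qed measurable
  then show ?thesis by (simp only: integral_mult_right_zero integral_Cauchy_kernel) (simp add: mult.commute)
qed

subsection \<open>Spectral bound for dominated functions\<close>

text \<open>Unlike \<open>fourier_transform\<close> this has the positive sign in the exponent and
  no normalising factor, so that convolution becomes multiplication with no constant.\<close>

definition fourier_integral :: "(real \<Rightarrow> real) \<Rightarrow> real \<Rightarrow> complex" where
  "fourier_integral c \<xi> = (LINT x|lborel. c x *\<^sub>R cis (x * \<xi>))"

lemma borel_measurable_fourier_integral [measurable]:
  assumes [measurable]: "c \<in> borel_measurable borel"
  shows "fourier_integral c \<in> borel_measurable borel"
  unfolding fourier_integral_def[abs_def] by measurable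

text \<open>The kernels depend on \<open>x\<close> and \<open>y\<close> separately because two
  limits are taken this way: Abel means of \<Phi> at \<open>x - y\<close>, and \<Phi> at differences
  of discretised points.\<close>

lemma double_integral_dominated_convergence:
  fixes c :: "real \<Rightarrow> real" and G :: "nat \<Rightarrow> real \<Rightarrow> real \<Rightarrow> real"
  assumes c: "integrable lborel c"
    and G[measurable]: "\<And>n. (\<lambda>(x, y). G n x y) \<in> borel_measurable (lborel \<Otimes>\<^sub>M lborel)"
    and G'[measurable]: "(\<lambda>(x, y). G' x y) \<in> borel_measurable (lborel \<Otimes>\<^sub>M lborel)"
    and bound: "\<And>n x y. \<bar>G n x y\<bar> \<le> B"
    and lim: "\<And>x y. (\<lambda>n. G n x y) \<longlonglongrightarrow> G' x y"
  shows "(\<lambda>n. LINT x|lborel. c x * (LINT y|lborel. c y * G n x y))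
    \<longlonglongrightarrow> (LINT x|lborel. c x * (LINT y|lborel. c y * G' x y))"
proof -
  have [measurable]: "c \<in> borel_measurable borel" using c by auto
  have w: "integrable lborel (\<lambda>y. \<bar>c y\<bar> * B)" using c by simp
  have le: "\<bar>c y * G n x y\<bar> \<le> \<bar>c y\<bar> * B" for n x y
    using bound by (simp add: abs_mult mult_left_mono)
  have int: "integrable lborel (\<lambda>y. c y * G n x y)" for n x
  proof (rule Bochner_Integration.integrable_bound[OF w])
    show "AE y in lborel. norm (c y * G n x y) \<le> norm (\<bar>c y\<bar> * B)"
      by (auto simp only: real_norm_def intro!: AE_I2 order_trans[OF le abs_ge_self])
  qed measurable
  have inner: "(\<lambda>n. LINT y|lborel. c y * G n x y) \<longlonglongrightarrow> (LINT y|lborel. c y * G' x y)" for x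
    by (rule integral_dominated_convergence[OF _ _ w]) (use le lim in \<open>auto intro!: tendsto_intros\<close>)
  have inner_le: "\<bar>LINT y|lborel. c y * G n x y\<bar> \<le> (LINT y|lborel. \<bar>c y\<bar> * B)" for n x
    by (rule Bochner_Integration.integral_abs_bound_integral[OF int w]) (rule le)
  show ?thesis
  proof (rule integral_dominated_convergence)
    show "integrable lborel (\<lambda>x. \<bar>c x\<bar> * (LINT y|lborel. \<bar>c y\<bar> * B))" using c by simp
    show "AE x in lborel. norm (c x * (LINT y|lborel. c y * G n x y)) \<le> \<bar>c x\<bar> * (LINT y|lborel. \<bar>c y\<bar> * B)" for n
      using inner_le[of n] by (intro AE_I2) (simp only: real_norm_def abs_mult, intro mult_left_mono, auto)
  qed (use inner in \<open>auto intro!: tendsto_intros\<close>)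
qed

text \<open>The addition theorem splits the kernel into two rank-one pieces, whose contributions are
  the squares of the real and imaginary parts. Each frequency thus contributes a nonnegative
  form.\<close>

lemma integral_quadratic_cos:
  assumes c: "integrable lborel c"
  shows "(LINT x|lborel. c x * (LINT y|lborel. c y * cos ((x - y) * \<xi>))) = (norm (fourier_integral c \<xi>))\<^sup>2"
proof -
  have ic: "integrable lborel (\<lambda>x. c x * cos (x * \<xi>))" and i_sin: "integrable lborel (\<lambda>x. c x * sin (x * \<xi>))"
    by (auto intro!: integrable_mult_bounded[OF c, of _ 1])
  have i: "integrable lborel (\<lambda>x. c x *\<^sub>R cis (x * \<xi>))"
    by (auto intro!: integrable_scaleR_bounded[OF c, of _ 1])
  define p q where "p = (LINT x|lborel. c x * cos (x * \<xi>))" and "q = (LINT x|lborel. c x * sin (x * \<xi>))"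
  have inner: "(LINT y|lborel. c y * cos ((x - y) * \<xi>)) = cos (x * \<xi>) * p + sin (x * \<xi>) * q" for x
  proof -
    have "(LINT y|lborel. c y * cos ((x - y) * \<xi>))
        = (LINT y|lborel. cos (x * \<xi>) * (c y * cos (y * \<xi>)) + sin (x * \<xi>) * (c y * sin (y * \<xi>)))"
      by (intro Bochner_Integration.integral_cong refl) (simp add: left_diff_distrib cos_diff algebra_simps)
    also have "\<dots> = cos (x * \<xi>) * p + sin (x * \<xi>) * q"
      unfolding p_def q_def using ic i_sin by (subst Bochner_Integration.integral_add) auto
    finally show ?thesis .
  qed
  have "(LINT x|lborel. c x * (LINT y|lborel. c y * cos ((x - y) * \<xi>)))
      = (LINT x|lborel. c x * cos (x * \<xi>) * p + c x * sin (x * \<xi>) * q)"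
    unfolding inner by (simp add: algebra_simps)
  also have "\<dots> = p * p + q * q"
    using ic i_sin by (subst Bochner_Integration.integral_add) (auto simp: p_def q_def)
  finally have "(LINT x|lborel. c x * (LINT y|lborel. c y * cos ((x - y) * \<xi>))) = p * p + q * q" .
  moreover have "p = Re (fourier_integral c \<xi>)" "q = Im (fourier_integral c \<xi>)"
    using integral_Re[OF i] integral_Im[OF i] by (simp_all add: p_def q_def fourier_integral_def)
  ultimately show ?thesis by (simp add: cmod_power2 flip: power2_eq_square)
qed

text \<open>
  Abel summation replaces the inversion formula for $\Phi$, so that neither integrability nor
  nonnegativity of its Fourier transform has to be known.
\<close>

lemma quadratic_form_le_spectral:
  fixes \<Phi> c :: "real \<Rightarrow> real"
  assumes cont: "continuous_on UNIV \<Phi>" and int: "integrable lborel \<Phi>"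
    and even: "\<And>x. \<Phi> (- x) = \<Phi> x" and bound: "\<And>x. \<bar>\<Phi> x\<bar> \<le> B"
    and c: "integrable lborel c"
    and w: "integrable lborel (\<lambda>\<xi>. (norm (fourier_integral c \<xi>))\<^sup>2 * max 0 (cosine_transform \<Phi> \<xi>))"
  shows "2 * pi * (LINT x|lborel. c x * (LINT y|lborel. c y * \<Phi> (x - y)))
    \<le> (LINT \<xi>|lborel. (norm (fourier_integral c \<xi>))\<^sup>2 * max 0 (cosine_transform \<Phi> \<xi>))"
proof -
  have [measurable]: "\<Phi> \<in> borel_measurable borel" "c \<in> borel_measurable borel" using int c by auto
  define e :: "nat \<Rightarrow> real" where "e n = 1 / Suc n" for n
  have e0: "0 < e n" for n by (simp add: e_def)
  have e: "e \<longlonglongrightarrow> 0" unfolding e_def by real_asymp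
  define A where "A n t = (LINT z|lborel. \<Phi> (t + e n * z) * (2 / (1 + z\<^sup>2)))" for n t
  have [measurable]: "A n \<in> borel_measurable borel" for n
    unfolding A_def[abs_def] by measurable
  have "(\<lambda>n. LINT x|lborel. c x * (LINT y|lborel. c y * A n (x - y)))
    \<longlonglongrightarrow> (LINT x|lborel. c x * (LINT y|lborel. c y * (2 * pi * \<Phi> (x - y))))"
  proof (rule double_integral_dominated_convergence[OF c])
    show "\<bar>A n (x - y)\<bar> \<le> 2 * pi * B" for n x y
      unfolding A_def by (rule abs_Poisson_mean_le) (use bound in auto)
    show "(\<lambda>n. A n (x - y)) \<longlonglongrightarrow> 2 * pi * \<Phi> (x - y)" for x y
      unfolding A_def using cont bound e by (rule Poisson_mean_tendsto)
  qed measurable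
  also have "(LINT x|lborel. c x * (LINT y|lborel. c y * (2 * pi * \<Phi> (x - y))))
      = 2 * pi * (LINT x|lborel. c x * (LINT y|lborel. c y * \<Phi> (x - y)))"
    by (simp add: mult.left_commute[of _ "2 * pi"] del: mult.assoc)
  finally have lim: "(\<lambda>n. LINT x|lborel. c x * (LINT y|lborel. c y * A n (x - y)))
    \<longlonglongrightarrow> 2 * pi * (LINT x|lborel. c x * (LINT y|lborel. c y * \<Phi> (x - y)))" .
  have "(LINT x|lborel. c x * (LINT y|lborel. c y * A n (x - y)))
      \<le> (LINT \<xi>|lborel. (norm (fourier_integral c \<xi>))\<^sup>2 * max 0 (cosine_transform \<Phi> \<xi>))" for n
  proof -
    define a where "a \<xi> = exp (- (e n * \<bar>\<xi>\<bar>)) * cosine_transform \<Phi> \<xi>" for \<xi>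
    have a: "integrable lborel a"
      unfolding a_def using abs_cosine_transform_le[OF int]
      by (intro integrable_mult_bounded[OF integrable_two_sided_exponential[OF e0]]) auto
    have A_eq: "A n t = (LINT \<xi>|lborel. a \<xi> * cos (t * \<xi>))" for t
      unfolding A_def a_def Poisson_mean[OF int even e0, symmetric] by (simp add: mult.assoc)
    have q_bound: "\<bar>LINT y|lborel. c y * cos ((x - y) * \<xi>)\<bar> \<le> (LINT y|lborel. \<bar>c y\<bar>)" for x \<xi>
      by (rule Bochner_Integration.integral_abs_bound_integral)
         (use c in \<open>auto intro!: integrable_mult_bounded[OF c, of _ 1] mult_left_le simp: abs_mult[of "c _"]\<close>)
    have "(LINT x|lborel. c x * (LINT y|lborel. c y * A n (x - y)))
        = (LINT x|lborel. c x * (LINT \<xi>|lborel. a \<xi> * (LINT y|lborel. c y * cos ((x - y) * \<xi>))))"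
      unfolding A_eq
      using Fubini_bounded_kernel[OF c a, of "\<lambda>y \<xi>. cos ((x - y) * \<xi>)" 1 for x] by simp
    \<comment> \<open>In this second interchange the integral over \<open>y\<close> is itself the
      bounded kernel.\<close>
    also have "\<dots> = (LINT \<xi>|lborel. a \<xi> * (LINT x|lborel. c x * (LINT y|lborel. c y * cos ((x - y) * \<xi>))))"
      using Fubini_bounded_kernel[OF c a, of "\<lambda>x \<xi>. (LINT y|lborel. c y * cos ((x - y) * \<xi>))"
          "LINT y|lborel. \<bar>c y\<bar>"] q_bound by simp
    \<comment> \<open>The factor coming from \<open>c\<close> is a square, so passing to the
      positive part of the transform and dropping the damping can only increase the
      integrand.\<close>
    also have "\<dots> \<le> (LINT \<xi>|lborel. (norm (fourier_integral c \<xi>))\<^sup>2 * max 0 (cosine_transform \<Phi> \<xi>))"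
      unfolding integral_quadratic_cos[OF c]
    proof (rule integral_mono_AE')
      show "AE \<xi> in lborel. a \<xi> * (norm (fourier_integral c \<xi>))\<^sup>2
          \<le> (norm (fourier_integral c \<xi>))\<^sup>2 * max 0 (cosine_transform \<Phi> \<xi>)"
      proof (rule AE_I2)
        fix \<xi>
        have "a \<xi> \<le> exp (- (e n * \<bar>\<xi>\<bar>)) * max 0 (cosine_transform \<Phi> \<xi>)"
          unfolding a_def by (intro mult_left_mono) auto
        also have "\<dots> \<le> 1 * max 0 (cosine_transform \<Phi> \<xi>)"
          using e0[of n] by (intro mult_right_mono) auto
        finally show "a \<xi> * (norm (fourier_integral c \<xi>))\<^sup>2
          \<le> (norm (fourier_integral c \<xi>))\<^sup>2 * max 0 (cosine_transform \<Phi> \<xi>)"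
          by (subst mult.commute) (simp add: mult_left_mono)
      qed
    qed (use w in auto)
    finally show ?thesis .
  qed
  then show ?thesis by (intro LIMSEQ_le_const2[OF lim]) auto
qed

text \<open>A simple function concentrates the density \<open>c\<close> into finitely many point
  masses, one for each of its values. This is the shape in which the finite sums of
  \<open>dominated\<close> can be applied.\<close>

lemma integral_comp_simple_function:
  fixes c g s :: "real \<Rightarrow> real"
  assumes c: "integrable lborel c" and s: "simple_function lborel s"
  shows "(LINT x|lborel. c x * g (s x))
    = (\<Sum>b\<in>range s. (LINT x|lborel. c x * indicator (s -` {b}) x) * g b)"
proof -
  have fin: "finite (range s)" using simple_functionD(1)[OF s] by simp
  have sets: "s -` {b} \<in> sets borel" for b
    using simple_functionD(2)[OF s, of "{b}"] by simp
  have int: "integrable lborel (\<lambda>x. c x * indicator (s -` {b}) x * g b)" for b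
    by (intro integrable_mult_left integrable_mult_bounded[OF c, of _ 1] borel_measurable_indicator sets)
       (simp add: indicator_def)
  have "c x * g (s x) = (\<Sum>b\<in>range s. c x * indicator (s -` {b}) x * g b)" for x
  proof -
    have "(\<Sum>b\<in>range s. c x * indicator (s -` {b}) x * g b) = (\<Sum>b\<in>{s x}. c x * indicator (s -` {b}) x * g b)"
      by (rule sum.mono_neutral_right) (use fin in \<open>auto simp: indicator_def\<close>)
    then show ?thesis by simp
  qed
  then have "(LINT x|lborel. c x * g (s x)) = (LINT x|lborel. (\<Sum>b\<in>range s. c x * indicator (s -` {b}) x * g b))"
    by simp
  also have "\<dots> = (\<Sum>b\<in>range s. (LINT x|lborel. c x * indicator (s -` {b}) x) * g b)"
    by (subst Bochner_Integration.integral_sum) (use int in auto)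
  finally show ?thesis .
qed

text \<open>
  The reproducing kernel Hilbert space enters only through \<open>dominated\<close>, which is equivalent to
  $f \in H$ with $\|f\|^2 \le M$.
\<close>

locale kernel_dominated =
  fixes \<Phi> f :: "real \<Rightarrow> real" and M :: real
  assumes kernel_continuous: "continuous_on UNIV \<Phi>"
    and kernel_integrable: "integrable lborel \<Phi>"
    and kernel_even: "\<Phi> (- x) = \<Phi> x"
    and kernel_bounded: "\<bar>\<Phi> x\<bar> \<le> \<Phi> 0"
    and bound_nonneg: "0 \<le> M"
    and dominated: "finite A \<Longrightarrow> (\<Sum>a\<in>A. c a * f a)\<^sup>2 \<le> M * (\<Sum>a\<in>A. \<Sum>b\<in>A. c a * c b * \<Phi> (a - b))"
begin

text \<open>Masses 1 and -1 at two points turn \<open>dominated\<close> into a modulus of continuity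
  for \<open>f\<close>, governed by that of \<Phi> at 0.\<close>

lemma continuous: "continuous_on UNIV f"
proof -
  have osc: "(f y - f x)\<^sup>2 \<le> M * (2 * \<Phi> 0 - 2 * \<Phi> (y - x))" for x y
  proof (cases "x = y")
    case False
    show ?thesis
      using dominated[of "{x, y}" "\<lambda>z. if z = y then 1 else - 1"] False kernel_even[of "x - y"]
      by (simp add: algebra_simps)
  qed simp
  have "isCont f x" for x
  proof -
    have "isCont \<Phi> 0" using kernel_continuous by (simp add: continuous_on_eq_continuous_at)
    then have "((\<lambda>y. \<Phi> (y - x)) \<longlongrightarrow> \<Phi> 0) (at x)"
      by (rule isCont_tendsto_compose) (auto intro!: tendsto_eq_intros)
    then have "((\<lambda>y. M * (2 * \<Phi> 0 - 2 * \<Phi> (y - x))) \<longlongrightarrow> M * (2 * \<Phi> 0 - 2 * \<Phi> 0)) (at x)"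
      by (intro tendsto_intros)
    then have lim: "((\<lambda>y. M * (2 * \<Phi> 0 - 2 * \<Phi> (y - x))) \<longlongrightarrow> 0) (at x)"
      by (simp only: diff_self mult_zero_right)
    have "((\<lambda>y. (f y - f x)\<^sup>2) \<longlongrightarrow> 0) (at x)"
      by (rule tendsto_sandwich[OF always_eventually always_eventually tendsto_const lim])
         (simp_all only: zero_le_power2 osc simp_thms)
    then have "((\<lambda>y. \<bar>f y - f x\<bar>) \<longlongrightarrow> 0) (at x)"
      using tendsto_real_sqrt by fastforce
    then have "((\<lambda>y. f y - f x) \<longlongrightarrow> 0) (at x)"
      by (simp only: tendsto_rabs_zero_iff)
    then show ?thesis by (simp add: isCont_def LIM_zero_iff)
  qed
  then show ?thesis by (simp add: continuous_at_imp_continuous_on)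
qed

lemma borel_measurable: "f \<in> borel_measurable borel"
  using continuous by (rule borel_measurable_continuous_onI)

lemma bounded: "\<bar>f x\<bar> \<le> sqrt (M * \<Phi> 0)"
  using dominated[of "{x}" "\<lambda>_. 1"] by (intro real_le_rsqrt) simp

text \<open>The identity map, rather than \<open>c\<close>, is approximated by simple functions
  \<open>s n\<close>: the mass of \<open>c\<close> is moved to the finitely many values of
  \<open>s n\<close>, and continuity of \<open>f\<close> and \<Phi> brings it back in the
  limit.\<close>

lemma integral_dominated:
  assumes c: "integrable lborel c"
  shows "(LINT x|lborel. c x * f x)\<^sup>2 \<le> M * (LINT x|lborel. c x * (LINT y|lborel. c y * \<Phi> (x - y)))"
proof -
  have [measurable]: "\<Phi> \<in> borel_measurable borel" "c \<in> borel_measurable borel" "f \<in> borel_measurable borel"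
    using kernel_integrable c borel_measurable by auto
  obtain s :: "nat \<Rightarrow> real \<Rightarrow> real" where simple: "\<And>n. simple_function lborel (s n)"
    and s: "\<And>x. (\<lambda>n. s n x) \<longlonglongrightarrow> x"
    using borel_measurable_implies_sequence_metric[of "\<lambda>x. x" lborel 0] by auto
  have [measurable]: "s n \<in> borel_measurable borel" for n
    using borel_measurable_simple_function[OF simple] by simp
  have comp: "(\<lambda>n. g (t n)) \<longlonglongrightarrow> g x" if "continuous_on UNIV g" "t \<longlonglongrightarrow> x" for g t and x :: real
    using that isCont_tendsto_compose[of x g t] by (simp add: continuous_on_eq_continuous_at)
  have "(LINT x|lborel. c x * f (s n x))\<^sup>2 \<le> M * (LINT x|lborel. c x * (LINT y|lborel. c y * \<Phi> (s n x - s n y)))" for n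
  proof -
    define d where "d b = (LINT x|lborel. c x * indicator (s n -` {b}) x)" for b
    have *: "(LINT x|lborel. c x * g (s n x)) = (\<Sum>b\<in>range (s n). d b * g b)" for g
      unfolding d_def by (rule integral_comp_simple_function[OF c simple])
    have "(LINT x|lborel. c x * (LINT y|lborel. c y * \<Phi> (s n x - s n y)))
        = (\<Sum>a\<in>range (s n). d a * (\<Sum>b\<in>range (s n). d b * \<Phi> (a - b)))"
      using *[of "\<lambda>a. LINT y|lborel. c y * \<Phi> (a - s n y)"] *[of "\<lambda>b. \<Phi> (a - b)" for a] by simp
    also have "\<dots> = (\<Sum>a\<in>range (s n). \<Sum>b\<in>range (s n). d a * d b * \<Phi> (a - b))"
      by (simp add: sum_distrib_left mult.assoc)
    finally show ?thesis
      using dominated[of "range (s n)" d] simple_functionD(1)[OF simple, of n] *[of f] by simp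
  qed
  moreover have "(\<lambda>n. LINT x|lborel. c x * f (s n x)) \<longlonglongrightarrow> (LINT x|lborel. c x * f x)"
  proof (rule integral_dominated_convergence)
    show "integrable lborel (\<lambda>x. \<bar>c x\<bar> * sqrt (M * \<Phi> 0))" using c by simp
    show "AE x in lborel. (\<lambda>n. c x * f (s n x)) \<longlonglongrightarrow> c x * f x"
      using comp[OF continuous s] by (intro AE_I2 tendsto_mult tendsto_const)
    show "AE x in lborel. norm (c x * f (s n x)) \<le> \<bar>c x\<bar> * sqrt (M * \<Phi> 0)" for n
      using bounded by (intro AE_I2) (simp only: real_norm_def abs_mult, intro mult_left_mono, auto)
  qed measurable
  then have "(\<lambda>n. (LINT x|lborel. c x * f (s n x))\<^sup>2) \<longlonglongrightarrow> (LINT x|lborel. c x * f x)\<^sup>2"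
    by (rule tendsto_power)
  moreover have "(\<lambda>n. LINT x|lborel. c x * (LINT y|lborel. c y * \<Phi> (s n x - s n y)))
    \<longlonglongrightarrow> (LINT x|lborel. c x * (LINT y|lborel. c y * \<Phi> (x - y)))"
    by (rule double_integral_dominated_convergence[OF c, where B = "\<Phi> 0"])
       (auto intro!: kernel_bounded comp[OF kernel_continuous] tendsto_diff s)
  then have "(\<lambda>n. M * (LINT x|lborel. c x * (LINT y|lborel. c y * \<Phi> (s n x - s n y))))
    \<longlonglongrightarrow> M * (LINT x|lborel. c x * (LINT y|lborel. c y * \<Phi> (x - y)))"
    by (intro tendsto_intros)
  ultimately show ?thesis by (intro LIMSEQ_le) auto
qed

lemma integral_dominated_spectral:
  assumes c: "integrable lborel c"
    and w: "integrable lborel (\<lambda>\<xi>. (norm (fourier_integral c \<xi>))\<^sup>2 * max 0 (cosine_transform \<Phi> \<xi>))"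
  shows "2 * pi * (LINT x|lborel. c x * f x)\<^sup>2
    \<le> M * (LINT \<xi>|lborel. (norm (fourier_integral c \<xi>))\<^sup>2 * max 0 (cosine_transform \<Phi> \<xi>))"
proof -
  have "2 * pi * (LINT x|lborel. c x * f x)\<^sup>2
      \<le> 2 * pi * (M * (LINT x|lborel. c x * (LINT y|lborel. c y * \<Phi> (x - y))))"
    by (intro mult_left_mono integral_dominated[OF c]) simp
  also have "\<dots> = M * (2 * pi * (LINT x|lborel. c x * (LINT y|lborel. c y * \<Phi> (x - y))))" by simp
  also have "\<dots> \<le> M * (LINT \<xi>|lborel. (norm (fourier_integral c \<xi>))\<^sup>2 * max 0 (cosine_transform \<Phi> \<xi>))"
    by (intro mult_left_mono bound_nonneg
        quadratic_form_le_spectral[OF kernel_continuous kernel_integrable kernel_even kernel_bounded c w])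
  finally show ?thesis .
qed

end

subsection \<open>Convolution powers of a one-sided kernel\<close>

lemma norm_exp_partial_sum_le: "norm (\<Sum>j<N. z ^ j / fact j) \<le> exp (norm z)" for z :: complex
proof -
  have "norm (\<Sum>j<N. z ^ j / fact j) \<le> (\<Sum>j<N. norm z ^ j / fact j)"
    by (rule order_trans[OF norm_sum]) (simp add: norm_divide norm_power)
  also have "\<dots> \<le> exp (norm z)"
    using sum_le_suminf[OF summable_exp[of "norm z"], of "{..<N}"]
    by (simp add: exp_def divide_inverse mult.commute)
  finally show ?thesis .
qed

lemma exp_partial_sum_tendsto: "(\<lambda>N. \<Sum>j<N. z ^ j / fact j) \<longlonglongrightarrow> exp z" for z :: "'a::{real_normed_field, banach}"
  using exp_converges[of z] by (simp add: sums_def scaleR_conv_of_real divide_inverse mult.commute)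

lemma integrable_inverse_square_plus:
  fixes l :: real
  assumes "1 \<le> l"
  shows "integrable lborel (\<lambda>\<xi>. 1 / (l\<^sup>2 + \<xi>\<^sup>2))"
proof (rule Bochner_Integration.integrable_bound[OF integrable_Cauchy_kernel])
  have "1 \<le> l\<^sup>2" using assms by (simp add: one_le_power)
  then have "1 / (l\<^sup>2 + \<xi>\<^sup>2) \<le> 2 / (1 + \<xi>\<^sup>2)" for \<xi>
    by (intro frac_le) (auto intro: add_pos_nonneg)
  then show "AE \<xi> in lborel. norm (1 / (l\<^sup>2 + \<xi>\<^sup>2)) \<le> norm (2 / (1 + \<xi>\<^sup>2))"
    by simp
qed measurable

lemma fourier_integral_sum:
  assumes "\<And>j. j \<in> J \<Longrightarrow> integrable lborel (c j)"
  shows "fourier_integral (\<lambda>x. \<Sum>j\<in>J. a j * c j x) \<xi> = (\<Sum>j\<in>J. of_real (a j) * fourier_integral (c j) \<xi>)"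
proof -
  have i: "integrable lborel (\<lambda>x. c j x *\<^sub>R cis (x * \<xi>))" if "j \<in> J" for j
    by (rule integrable_scaleR_bounded[OF assms[OF that], of _ 1]) auto
  have "fourier_integral (\<lambda>x. \<Sum>j\<in>J. a j * c j x) \<xi>
      = (LINT x|lborel. (\<Sum>j\<in>J. of_real (a j) * (c j x *\<^sub>R cis (x * \<xi>))))"
    unfolding fourier_integral_def
    by (intro Bochner_Integration.integral_cong refl) (simp add: scaleR_conv_of_real sum_distrib_right mult.assoc)
  also have "\<dots> = (\<Sum>j\<in>J. of_real (a j) * fourier_integral (c j) \<xi>)"
    unfolding fourier_integral_def
    by (subst Bochner_Integration.integral_sum, intro integrable_mult_right i, assumption)
       (simp only: integral_mult_right_zero)
  finally show ?thesis .
qed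

text \<open>Only the rates 1, 2, 3, ... occur in the end. The bound \<open>1 \<le> l\<close> keeps
  the comparisons of l^2 + x^2 with 1 + x^2 and with l free of constants.\<close>

locale vanishing_kernel_dominated = kernel_dominated +
  fixes l :: real
  assumes vanishing: "0 \<le> x \<Longrightarrow> f x = 0"
    and rate: "1 \<le> l"
begin

text \<open>This is the Laplace transform at \<open>l\<close> of the reflection of
  \<open>f\<close>.\<close>

definition moment :: real where
  "moment = (LINT x|lborel. (indicator {..<0} x * exp (l * x)) * f x)"

text \<open>The denominator is the squared modulus of l + i \<xi>: the transform of the cut-off
  exponential is absorbed into the weight, leaving only the multiplier coming from \<open>k\<close>
  in the integrals below.\<close>

definition spectral_weight :: "real \<Rightarrow> real" where
  "spectral_weight \<xi> = max 0 (cosine_transform \<Phi> \<xi>) / (l\<^sup>2 + \<xi>\<^sup>2)"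

lemma rate_pos: "0 < l" using rate by simp

lemma denominator_pos: "0 < l\<^sup>2 + \<xi>\<^sup>2"
  using rate_pos by (simp add: add_pos_nonneg)

lemma spectral_weight_nonneg: "0 \<le> spectral_weight \<xi>"
  unfolding spectral_weight_def using denominator_pos[of \<xi>] by simp

lemma integrable_spectral_weight: "integrable lborel spectral_weight"
proof -
  have [measurable]: "\<Phi> \<in> borel_measurable borel" using kernel_integrable by auto
  have "\<bar>max 0 (cosine_transform \<Phi> \<xi>)\<bar> \<le> (LINT x|lborel. \<bar>\<Phi> x\<bar>)" for \<xi>
    using abs_cosine_transform_le[OF kernel_integrable, of \<xi>] by (auto simp: max_def)
  then have "integrable lborel (\<lambda>\<xi>. 1 / (l\<^sup>2 + \<xi>\<^sup>2) * max 0 (cosine_transform \<Phi> \<xi>))"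
    by (intro integrable_mult_bounded[OF integrable_inverse_square_plus[OF rate], where B = "LINT x|lborel. \<bar>\<Phi> x\<bar>"]) auto
  then show ?thesis by (simp add: spectral_weight_def[abs_def])
qed

lemma borel_measurable_spectral_weight: "spectral_weight \<in> borel_measurable borel"
  using integrable_spectral_weight by auto

text \<open>
  Only one-sided translates occur, and the part of the exponential shifted past the origin meets the
  zeros of $f$. This is the only place where the support hypothesis enters the estimate.
\<close>

lemma translate_eigenfunction:
  assumes "0 \<le> s"
  shows "(LINT x|lborel. (indicator {..<0} x * exp (l * x)) * f (x + s)) = exp (- (l * s)) * moment"
proof -
  have "(LINT x|lborel. (indicator {..<0} x * exp (l * x)) * f (x + s))
      = (LINT x|lborel. (indicator {..<0} (x - s) * exp (l * (x - s))) * f x)"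
    by (subst (2) lborel_integral_real_affine[of 1 _ s]) (auto simp: add.commute)
  also have "\<dots> = (LINT x|lborel. exp (- (l * s)) * ((indicator {..<0} x * exp (l * x)) * f x))"
    by (intro Bochner_Integration.integral_cong refl)
       (use assms in \<open>auto simp: indicator_def vanishing algebra_simps simp flip: exp_add\<close>)
  finally show ?thesis by (simp add: moment_def)
qed

text \<open>Convolving with \<open>k\<close> replaces \<open>f\<close> by its translates before
  pairing, so the induction has to carry the pairing with all translates by
  \<open>s \<ge> 0\<close>. Of the convolution power itself only its transform and these pairings
  are used later.\<close>

lemma exists_convolution_power:
  assumes k: "integrable lborel k" and supp: "\<And>y. y \<le> 0 \<Longrightarrow> k y = 0"
  shows "\<exists>c. integrable lborel c \<and> (\<forall>\<xi>. fourier_integral c \<xi> = fourier_integral k \<xi> ^ n / Complex l \<xi>)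
    \<and> (\<forall>s\<ge>0. (LINT x|lborel. c x * f (x + s))
        = (LINT y|lborel. k y * exp (- (l * y))) ^ n * exp (- (l * s)) * moment)"
proof (induction n)
  case 0
  define c where "c x = indicator {..<0} x * exp (l * x)" for x :: real
  have c_reflect: "c (- x) = indicator {0<..} x * exp (- (l * x))" for x
    by (auto simp: c_def indicator_def)
  have "integrable lborel (\<lambda>x. c (0 + - 1 * x))"
    using integrable_one_sided_exponential[OF rate_pos] by (simp add: c_reflect)
  then have "integrable lborel c"
    by (subst (asm) lborel_integrable_real_affine_iff) auto
  moreover have "fourier_integral c \<xi> = 1 / Complex l \<xi>" for \<xi>
    unfolding fourier_integral_def using integral_one_sided_exponential[OF rate_pos, of "- \<xi>"]
    by (subst lborel_integral_real_affine[of "-1" _ 0]) (auto simp: c_reflect)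
  ultimately show ?case
    using translate_eigenfunction unfolding c_def[symmetric] by (intro exI[of _ c]) simp
next
  case (Suc n)
  define K where "K = (LINT y|lborel. k y * exp (- (l * y)))"
  obtain c where c: "integrable lborel c"
    and ft: "\<And>\<xi>. fourier_integral c \<xi> = fourier_integral k \<xi> ^ n / Complex l \<xi>"
    and pair: "\<And>s. 0 \<le> s \<Longrightarrow> (LINT x|lborel. c x * f (x + s)) = K ^ n * exp (- (l * s)) * moment"
    using Suc.IH unfolding K_def by blast
  note [measurable] = borel_measurable
  define d where "d x = (LINT y|lborel. k y * c (x - y))" for x
  have "integrable lborel d"
    unfolding d_def by (rule integrable_convolution[OF k c])
  moreover have "fourier_integral d \<xi> = fourier_integral k \<xi> ^ Suc n / Complex l \<xi>" for \<xi>
  proof -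
    have "fourier_integral d \<xi> = (LINT y|lborel. k y *\<^sub>R (LINT x|lborel. c x *\<^sub>R cis ((x + y) * \<xi>)))"
      unfolding d_def fourier_integral_def
      by (rule integral_convolution_scaleR[OF k c, where g = "\<lambda>x. cis (x * \<xi>)" and B = 1]) auto
    also have "\<dots> = (LINT y|lborel. (k y *\<^sub>R cis (y * \<xi>)) * fourier_integral c \<xi>)"
    proof (intro Bochner_Integration.integral_cong refl)
      fix y
      have "(LINT x|lborel. c x *\<^sub>R cis ((x + y) * \<xi>)) = (LINT x|lborel. (c x *\<^sub>R cis (x * \<xi>)) * cis (y * \<xi>))"
        by (simp add: distrib_right cis_mult[symmetric])
      also have "\<dots> = fourier_integral c \<xi> * cis (y * \<xi>)"
        unfolding fourier_integral_def by (rule integral_mult_left_zero)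
      finally show "k y *\<^sub>R (LINT x|lborel. c x *\<^sub>R cis ((x + y) * \<xi>)) = (k y *\<^sub>R cis (y * \<xi>)) * fourier_integral c \<xi>"
        by simp
    qed
    also have "\<dots> = fourier_integral k \<xi> * fourier_integral c \<xi>"
      unfolding fourier_integral_def by (rule integral_mult_left_zero)
    finally show ?thesis by (simp add: ft)
  qed
  moreover have "(LINT x|lborel. d x * f (x + s)) = K ^ Suc n * exp (- (l * s)) * moment" if "0 \<le> s" for s
  proof -
    have "(LINT x|lborel. d x * f (x + s)) = (LINT y|lborel. k y * (LINT x|lborel. c x * f (x + (y + s))))"
      unfolding d_def
      using integral_convolution_scaleR[OF k c, where g = "\<lambda>x. f (x + s)" and B = "sqrt (M * \<Phi> 0)"] bounded
      by (simp add: add.assoc)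
    also have "\<dots> = (LINT y|lborel. (k y * exp (- (l * y))) * (K ^ n * exp (- (l * s)) * moment))"
    proof (intro Bochner_Integration.integral_cong refl)
      fix y
      \<comment> \<open>For \<open>y \<le> 0\<close> both sides vanish with \<open>k y\<close>;
        otherwise \<open>y + s\<close> lies in the range of the induction hypothesis.\<close>
      show "k y * (LINT x|lborel. c x * f (x + (y + s))) = (k y * exp (- (l * y))) * (K ^ n * exp (- (l * s)) * moment)"
        using that supp[of y] pair[of "y + s"]
        by (cases "y \<le> 0") (simp_all add: distrib_left flip: exp_add)
    qed
    also have "\<dots> = K * (K ^ n * exp (- (l * s)) * moment)"
      unfolding K_def by (rule integral_mult_left_zero)
    finally show ?thesis by simp
  qed
  ultimately show ?case unfolding K_def by blast
qed

text \<open>The spectral bound is applied to the partial sums of the convolution exponential of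
  \<open>k\<close>, which are integrable functions. Both sides then see partial sums of exponential
  series, in the number K and in the transform of \<open>k\<close>, and pass to the limit.\<close>

lemma exponential_bound:
  assumes k: "integrable lborel k" and supp: "\<And>y. y \<le> 0 \<Longrightarrow> k y = 0"
  shows "2 * pi * (exp (LINT y|lborel. k y * exp (- (l * y))) * moment)\<^sup>2
    \<le> M * (LINT \<xi>|lborel. exp (2 * Re (fourier_integral k \<xi>)) * spectral_weight \<xi>)"
proof -
  define K where "K = (LINT y|lborel. k y * exp (- (l * y)))"
  have [measurable]: "k \<in> borel_measurable borel" using k by auto
  note [measurable] = borel_measurable_spectral_weight
  define P where "P n c \<longleftrightarrow> integrable lborel c
      \<and> (\<forall>\<xi>. fourier_integral c \<xi> = fourier_integral k \<xi> ^ n / Complex l \<xi>)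
      \<and> (\<forall>s\<ge>0. (LINT x|lborel. c x * f (x + s)) = K ^ n * exp (- (l * s)) * moment)" for n c
  have "\<exists>c. P n c" for n
    unfolding P_def K_def by (rule exists_convolution_power[OF k supp])
  then obtain c where P: "P n (c n)" for n
    by metis
  have c: "integrable lborel (c n)"
    and ft: "fourier_integral (c n) \<xi> = fourier_integral k \<xi> ^ n / Complex l \<xi>" for n \<xi>
    using P[of n] by (simp_all add: P_def)
  have pair: "(LINT x|lborel. c n x * f x) = K ^ n * moment" for n
    using P[of n, unfolded P_def, THEN conjunct2, THEN conjunct2, rule_format, of 0] by simp
  define S where "S N z = (\<Sum>j<N. z ^ j / fact j)" for N and z :: complex
  define R where "R N z = (\<Sum>j<N. z ^ j / fact j)" for N and z :: real
  \<comment> \<open>The bound is uniform in \<open>N\<close> and in \<xi>, so a constant multiple of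
    the weight dominates all partial sums.\<close>
  have S_le: "norm (S N (fourier_integral k \<xi>)) \<le> exp (LINT x|lborel. \<bar>k x\<bar>)" for N \<xi>
  proof -
    have "norm (fourier_integral k \<xi>) \<le> (LINT x|lborel. norm (k x *\<^sub>R cis (x * \<xi>)))"
      unfolding fourier_integral_def by (rule integral_norm_bound)
    then show ?thesis
      using norm_exp_partial_sum_le[of "fourier_integral k \<xi>" N] unfolding S_def
      by (auto intro: order_trans)
  qed
  have dom: "(norm (S N (fourier_integral k \<xi>)))\<^sup>2 * spectral_weight \<xi>
      \<le> (exp (LINT x|lborel. \<bar>k x\<bar>))\<^sup>2 * spectral_weight \<xi>" for N \<xi>
    by (intro mult_right_mono power_mono S_le spectral_weight_nonneg) simp
  have w: "integrable lborel (\<lambda>\<xi>. (exp (LINT x|lborel. \<bar>k x\<bar>))\<^sup>2 * spectral_weight \<xi>)"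
    by (intro integrable_mult_right integrable_spectral_weight)
  have meas[measurable]: "(\<lambda>\<xi>. (norm (S N (fourier_integral k \<xi>)))\<^sup>2 * spectral_weight \<xi>) \<in> borel_measurable borel" for N
    unfolding S_def by measurable
  have step: "2 * pi * (R N K * moment)\<^sup>2
      \<le> M * (LINT \<xi>|lborel. (norm (S N (fourier_integral k \<xi>)))\<^sup>2 * spectral_weight \<xi>)" for N
  proof -
    define d where "d x = (\<Sum>j<N. inverse (fact j) * c j x)" for x
    have d: "integrable lborel d"
      unfolding d_def by (intro Bochner_Integration.integrable_sum integrable_mult_right c)
    have ft_d: "fourier_integral d \<xi> = S N (fourier_integral k \<xi>) / Complex l \<xi>" for \<xi>
      unfolding d_def S_def using c
      by (subst fourier_integral_sum) (simp_all add: ft sum_distrib_left divide_inverse mult_ac)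
    have eq: "(norm (fourier_integral d \<xi>))\<^sup>2 * max 0 (cosine_transform \<Phi> \<xi>)
        = (norm (S N (fourier_integral k \<xi>)))\<^sup>2 * spectral_weight \<xi>" for \<xi>
      by (simp add: ft_d norm_divide power_divide cmod_power2 spectral_weight_def)
    have int_c: "integrable lborel (\<lambda>x. c j x * f x)" for j
      using borel_measurable bounded by (intro integrable_mult_bounded[OF c]) auto
    have "(LINT x|lborel. d x * f x) = (LINT x|lborel. (\<Sum>j<N. inverse (fact j) * (c j x * f x)))"
      unfolding d_def by (simp add: sum_distrib_right mult.assoc)
    also have "\<dots> = (\<Sum>j<N. inverse (fact j) * (LINT x|lborel. c j x * f x))"
      by (subst Bochner_Integration.integral_sum) (auto intro!: integrable_mult_right int_c)
    also have "\<dots> = R N K * moment"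
      unfolding pair R_def by (simp add: sum_distrib_left divide_inverse mult_ac)
    finally have pair_d: "(LINT x|lborel. d x * f x) = R N K * moment" .
    have "integrable lborel (\<lambda>\<xi>. (norm (S N (fourier_integral k \<xi>)))\<^sup>2 * spectral_weight \<xi>)"
    proof (rule Bochner_Integration.integrable_bound[OF w])
      show "AE \<xi> in lborel. norm ((norm (S N (fourier_integral k \<xi>)))\<^sup>2 * spectral_weight \<xi>)
          \<le> norm ((exp (LINT x|lborel. \<bar>k x\<bar>))\<^sup>2 * spectral_weight \<xi>)"
        using dom[of N] by (intro AE_I2) (simp add: abs_mult spectral_weight_nonneg)
    qed measurable
    then show ?thesis
      by (rule integral_dominated_spectral[OF d, unfolded eq pair_d])
  qed
  have "(\<lambda>N. 2 * pi * (R N K * moment)\<^sup>2) \<longlonglongrightarrow> 2 * pi * (exp K * moment)\<^sup>2"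
    unfolding R_def by (intro tendsto_intros exp_partial_sum_tendsto)
  moreover have "(\<lambda>N. LINT \<xi>|lborel. (norm (S N (fourier_integral k \<xi>)))\<^sup>2 * spectral_weight \<xi>)
    \<longlonglongrightarrow> (LINT \<xi>|lborel. (norm (exp (fourier_integral k \<xi>)))\<^sup>2 * spectral_weight \<xi>)"
  proof (rule integral_dominated_convergence[OF _ _ w])
    show "AE \<xi> in lborel. (\<lambda>N. (norm (S N (fourier_integral k \<xi>)))\<^sup>2 * spectral_weight \<xi>)
      \<longlonglongrightarrow> (norm (exp (fourier_integral k \<xi>)))\<^sup>2 * spectral_weight \<xi>"
      unfolding S_def by (intro AE_I2 tendsto_intros exp_partial_sum_tendsto)
    show "AE \<xi> in lborel. norm ((norm (S N (fourier_integral k \<xi>)))\<^sup>2 * spectral_weight \<xi>)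
        \<le> (exp (LINT x|lborel. \<bar>k x\<bar>))\<^sup>2 * spectral_weight \<xi>" for N
      using dom[of N] by (intro AE_I2) (simp add: abs_mult spectral_weight_nonneg)
  qed measurable
  then have "(\<lambda>N. M * (LINT \<xi>|lborel. (norm (S N (fourier_integral k \<xi>)))\<^sup>2 * spectral_weight \<xi>))
    \<longlonglongrightarrow> M * (LINT \<xi>|lborel. (norm (exp (fourier_integral k \<xi>)))\<^sup>2 * spectral_weight \<xi>)"
    by (intro tendsto_intros)
  ultimately have "2 * pi * (exp K * moment)\<^sup>2
      \<le> M * (LINT \<xi>|lborel. (norm (exp (fourier_integral k \<xi>)))\<^sup>2 * spectral_weight \<xi>)"
    by (rule LIMSEQ_le) (use step in auto)
  moreover have "(norm (exp z))\<^sup>2 = exp (2 * Re z)" for z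
    by (simp add: power2_eq_square flip: exp_add)
  ultimately show ?thesis by (simp add: K_def)
qed

end

subsection \<open>The weighted bound for exponential moments\<close>

context vanishing_kernel_dominated
begin

text \<open>Restriction to the half-line halves the integral of an even function. Against cosines
  this makes twice the real part of the transform of \<open>k\<close> a damped inversion integral
  for \<open>u\<close>, that is, an average of \<open>u\<close> at scale \<open>e\<close>. Against
  the exponential of rate \<open>l\<close> the damping only adds \<open>e\<close> to the
  rate.\<close>

lemma weighted_bound_regularised:
  assumes u: "integrable lborel u" and even: "\<And>x. u (- x) = u x" and e: "0 < e"
  shows "2 * pi * (exp ((LINT x|lborel. u x * ((l + e) / ((l + e)\<^sup>2 + x\<^sup>2))) / (2 * pi)) * moment)\<^sup>2
    \<le> M * (LINT \<xi>|lborel. exp ((LINT z|lborel. u (\<xi> + e * z) * (2 / (1 + z\<^sup>2))) / (2 * pi)) * spectral_weight \<xi>)"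
proof -
  have [measurable]: "u \<in> borel_measurable borel" using u by auto
  \<comment> \<open>Dividing by 2 pi compensates the mass of the kernel in
    \<open>Poisson_mean\<close>.\<close>
  define g where "g y = exp (- (e * \<bar>y\<bar>)) * cosine_transform u y / (2 * pi)" for y
  define k where "k y = indicator {0<..} y * g y" for y
  have g: "integrable lborel g"
    unfolding g_def using abs_cosine_transform_le[OF u]
    by (intro integrable_divide integrable_mult_bounded[OF integrable_two_sided_exponential[OF e]]) auto
  have g_even: "g (- y) = g y" for y by (simp add: g_def cosine_transform_minus)
  have k: "integrable lborel k"
    unfolding k_def using integrable_mult_bounded[OF g, of "indicator {0<..}" 1]
    by (simp add: mult.commute)
  have half: "(LINT y|lborel. k y * h y) = (LINT y|lborel. g y * h y) / 2"
    if [measurable]: "h \<in> borel_measurable borel" and "\<And>y. \<bar>h y\<bar> \<le> 1" and "\<And>y. h (- y) = h y" for h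
    using integral_even[of "\<lambda>y. g y * h y"] integrable_mult_bounded[OF g, of h 1] that g_even
    by (simp add: k_def mult.assoc)
  have cos_eq: "2 * Re (fourier_integral k \<xi>) = (LINT z|lborel. u (\<xi> + e * z) * (2 / (1 + z\<^sup>2))) / (2 * pi)" for \<xi>
  proof -
    have "integrable lborel (\<lambda>y. k y *\<^sub>R cis (y * \<xi>))"
      by (rule integrable_scaleR_bounded[OF k, of _ 1]) auto
    then have "2 * Re (fourier_integral k \<xi>) = 2 * (LINT y|lborel. k y * cos (y * \<xi>))"
      unfolding fourier_integral_def by (simp flip: integral_Re)
    also have "\<dots> = (LINT y|lborel. g y * cos (y * \<xi>))"
      by (subst half) auto
    also have "\<dots> = (LINT y|lborel. exp (- (e * \<bar>y\<bar>)) * (cosine_transform u y * cos (\<xi> * y)) / (2 * pi))"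
      by (intro Bochner_Integration.integral_cong refl) (simp add: g_def mult.commute[of \<xi>])
    also have "\<dots> = (LINT z|lborel. u (\<xi> + e * z) * (2 / (1 + z\<^sup>2))) / (2 * pi)"
      by (simp only: integral_divide_zero Poisson_mean[OF u even e])
    finally show ?thesis .
  qed
  have exp_eq: "(LINT y|lborel. k y * exp (- (l * y))) = (LINT x|lborel. u x * ((l + e) / ((l + e)\<^sup>2 + x\<^sup>2))) / (2 * pi)"
  proof -
    have le: "0 < l + e" using rate_pos e by simp
    have "(LINT y|lborel. k y * exp (- (l * y))) = (LINT y|lborel. k y * exp (- (l * \<bar>y\<bar>)))"
      by (intro Bochner_Integration.integral_cong refl) (auto simp: k_def indicator_def)
    also have "\<dots> = (LINT y|lborel. g y * exp (- (l * \<bar>y\<bar>))) / 2"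
      using rate_pos by (intro half) auto
    also have "(LINT y|lborel. g y * exp (- (l * \<bar>y\<bar>)))
        = (LINT y|lborel. exp (- ((l + e) * \<bar>y\<bar>)) * (LINT x|lborel. u x * cos (x * y)) / (2 * pi))"
      by (intro Bochner_Integration.integral_cong refl)
         (simp add: g_def cosine_transform_def algebra_simps flip: exp_add)
    also have "\<dots> = (LINT x|lborel. u x * (LINT y|lborel. exp (- ((l + e) * \<bar>y\<bar>)) * cos (x * y))) / (2 * pi)"
      using Fubini_bounded_kernel[OF integrable_two_sided_exponential[OF le] u, of "\<lambda>y x. cos (x * y)" 1]
      by simp
    also have "\<dots> = (LINT x|lborel. 2 * (u x * ((l + e) / ((l + e)\<^sup>2 + x\<^sup>2)))) / (2 * pi)"
      using integral_two_sided_exponential[OF le] by (simp add: mult.commute[of _ "_::real"] mult.left_commute)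
    also have "(LINT x|lborel. 2 * (u x * ((l + e) / ((l + e)\<^sup>2 + x\<^sup>2))))
        = 2 * (LINT x|lborel. u x * ((l + e) / ((l + e)\<^sup>2 + x\<^sup>2)))"
      by (rule integral_mult_right_zero)
    finally show ?thesis by simp
  qed
  show ?thesis
    using exponential_bound[OF k] unfolding cos_eq exp_eq by (simp add: k_def)
qed

lemma Poisson_kernel_nonneg: "0 \<le> l / (l\<^sup>2 + x\<^sup>2)"
  using rate_pos denominator_pos[of x] by simp

lemma Poisson_kernel_le: "l / (l\<^sup>2 + x\<^sup>2) \<le> 1"
proof -
  have "l \<le> l\<^sup>2" using rate by (simp add: power2_eq_square)
  then have "l \<le> l\<^sup>2 + x\<^sup>2" by (rule add_increasing2[OF zero_le_power2])
  then show ?thesis using denominator_pos[of x] by (simp add: divide_le_eq)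
qed

text \<open>Continuity makes the Poisson means converge at every point, and they inherit the bound
  \<open>B\<close>, so \<open>exp B\<close> times the weight dominates as the damping tends to
  0.\<close>

lemma weighted_bound_continuous:
  assumes cont: "continuous_on UNIV u" and u: "integrable lborel u"
    and even: "\<And>x. u (- x) = u x" and bound: "\<And>x. \<bar>u x\<bar> \<le> B"
  shows "2 * pi * (exp ((LINT x|lborel. u x * (l / (l\<^sup>2 + x\<^sup>2))) / (2 * pi)) * moment)\<^sup>2
    \<le> M * (LINT \<xi>|lborel. exp (u \<xi>) * spectral_weight \<xi>)"
proof -
  have [measurable]: "u \<in> borel_measurable borel" using u by auto
  note [measurable] = borel_measurable_spectral_weight
  define e :: "nat \<Rightarrow> real" where "e n = 1 / Suc n" for n
  have e0: "0 < e n" for n by (simp add: e_def)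
  have e: "e \<longlonglongrightarrow> 0" unfolding e_def by real_asymp
  define I where "I n = (LINT x|lborel. u x * ((l + e n) / ((l + e n)\<^sup>2 + x\<^sup>2)))" for n
  define P where "P n \<xi> = (LINT z|lborel. u (\<xi> + e n * z) * (2 / (1 + z\<^sup>2))) / (2 * pi)" for n \<xi>
  have [measurable]: "P n \<in> borel_measurable borel" for n
    unfolding P_def[abs_def] by measurable
  have P_lim: "(\<lambda>n. P n \<xi>) \<longlonglongrightarrow> u \<xi>" for \<xi>
    using tendsto_divide[OF Poisson_mean_tendsto[OF cont bound e, of \<xi>] tendsto_const, of "2 * pi"]
    unfolding P_def by simp
  have P_le: "P n \<xi> \<le> B" for n \<xi>
    using abs_Poisson_mean_le[of u B \<xi> "e n"] bound
    by (simp add: P_def abs_le_iff divide_le_eq mult.commute)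
  have I_lim: "I \<longlonglongrightarrow> (LINT x|lborel. u x * (l / (l\<^sup>2 + x\<^sup>2)))"
    unfolding I_def
  proof (rule integral_dominated_convergence)
    show "integrable lborel (\<lambda>x. \<bar>u x\<bar>)" using u by simp
    have "(\<lambda>n. u x * ((l + e n) / ((l + e n)\<^sup>2 + x\<^sup>2))) \<longlonglongrightarrow> u x * ((l + 0) / ((l + 0)\<^sup>2 + x\<^sup>2))" for x
      using denominator_pos[of x] by (intro tendsto_intros e) auto
    then show "AE x in lborel. (\<lambda>n. u x * ((l + e n) / ((l + e n)\<^sup>2 + x\<^sup>2))) \<longlonglongrightarrow> u x * (l / (l\<^sup>2 + x\<^sup>2))"
      by simp
    have "\<bar>(l + e n) / ((l + e n)\<^sup>2 + x\<^sup>2)\<bar> \<le> 1" for n x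
    proof -
      have "1 \<le> l + e n" using rate e0[of n] by simp
      then have "l + e n \<le> (l + e n)\<^sup>2" by (simp add: power2_eq_square)
      then have "l + e n \<le> (l + e n)\<^sup>2 + x\<^sup>2" by (rule add_increasing2[OF zero_le_power2])
      with \<open>1 \<le> l + e n\<close> show ?thesis by (simp add: divide_le_eq)
    qed
    then show "AE x in lborel. norm (u x * ((l + e n) / ((l + e n)\<^sup>2 + x\<^sup>2))) \<le> \<bar>u x\<bar>" for n
      by (intro AE_I2) (simp only: real_norm_def abs_mult mult_left_le abs_ge_zero)
  qed measurable
  have "(\<lambda>n. 2 * pi * (exp (I n / (2 * pi)) * moment)\<^sup>2)
    \<longlonglongrightarrow> 2 * pi * (exp ((LINT x|lborel. u x * (l / (l\<^sup>2 + x\<^sup>2))) / (2 * pi)) * moment)\<^sup>2"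
    by (intro tendsto_intros I_lim) simp
  moreover have "(\<lambda>n. LINT \<xi>|lborel. exp (P n \<xi>) * spectral_weight \<xi>)
    \<longlonglongrightarrow> (LINT \<xi>|lborel. exp (u \<xi>) * spectral_weight \<xi>)"
  proof (rule integral_dominated_convergence)
    show "integrable lborel (\<lambda>\<xi>. exp B * spectral_weight \<xi>)"
      by (intro integrable_mult_right integrable_spectral_weight)
    show "AE \<xi> in lborel. (\<lambda>n. exp (P n \<xi>) * spectral_weight \<xi>) \<longlonglongrightarrow> exp (u \<xi>) * spectral_weight \<xi>"
      by (intro AE_I2 tendsto_intros P_lim)
    show "AE \<xi> in lborel. norm (exp (P n \<xi>) * spectral_weight \<xi>) \<le> exp B * spectral_weight \<xi>" for n
      using P_le by (intro AE_I2) (simp add: abs_mult spectral_weight_nonneg mult_right_mono)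
  qed measurable
  then have "(\<lambda>n. M * (LINT \<xi>|lborel. exp (P n \<xi>) * spectral_weight \<xi>))
    \<longlonglongrightarrow> M * (LINT \<xi>|lborel. exp (u \<xi>) * spectral_weight \<xi>)"
    by (intro tendsto_intros)
  ultimately show ?thesis
    by (rule LIMSEQ_le)
       (use weighted_bound_regularised[OF u even e0] in \<open>auto simp: I_def P_def\<close>)
qed

text \<open>
  A continuous minorant of a measurable $\omega$ need not have a large logarithmic integral, so $v$ is only
  approximated almost everywhere by continuous functions, not from below.
\<close>

lemma weighted_bound_measurable:
  assumes v[measurable]: "v \<in> borel_measurable borel"
    and even: "\<And>x. v (- x) = v x" and bound: "\<And>x. 0 \<le> v x" "\<And>x. v x \<le> b"
    and supp: "\<And>x. r < \<bar>x\<bar> \<Longrightarrow> v x = 0"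
  shows "2 * pi * (exp ((LINT x|lborel. v x * (l / (l\<^sup>2 + x\<^sup>2))) / (2 * pi)) * moment)\<^sup>2
    \<le> M * (LINT \<xi>|lborel. exp (v \<xi>) * spectral_weight \<xi>)"
proof -
  note [measurable] = borel_measurable_spectral_weight
  have b: "0 \<le> b" using bound[of 0] by simp
  have "v \<in> borel_measurable lebesgue" by (rule measurable_completion) simp
  \<comment> \<open>By definition, \<open>measurable_on\<close> provides continuous functions
    converging off a negligible set.\<close>
  then have "v measurable_on UNIV" by (rule lebesgue_measurable_imp_measurable_on) simp
  then obtain N g where N: "negligible N" and g: "\<And>n. continuous_on UNIV (g n)"
    and lim: "\<And>x. x \<notin> N \<Longrightarrow> (\<lambda>n. g n x) \<longlonglongrightarrow> v x"
    unfolding measurable_on_def by auto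
  have [measurable]: "g n \<in> borel_measurable borel" for n
    using g by (rule borel_measurable_continuous_onI)
  have "AE x in lebesgue. x \<notin> N"
    using N by (intro AE_not_in) (simp add: negligible_iff_null_sets)
  then have ae: "AE x in lborel. (\<lambda>n. g n x) \<longlonglongrightarrow> v x"
    unfolding AE_completion_iff by eventually_elim (rule lim)
  then have "AE x in lborel. (\<lambda>n. g n (0 + (- 1) * x)) \<longlonglongrightarrow> v (0 + (- 1) * x)"
    by (intro AE_borel_affine) auto
  then have ae': "AE x in lborel. (\<lambda>n. g n (- x)) \<longlonglongrightarrow> v x"
    by (simp add: even)
  \<comment> \<open>An even continuous plateau: 1 where \<open>v\<close> may be nonzero, 0 beyond
    distance 1 from there.\<close>
  define t where "t x = max 0 (min 1 (r + 1 - \<bar>x\<bar>))" for x :: real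
  have t: "0 \<le> t x" "t x \<le> 1" "t (- x) = t x" and t0: "r + 1 < \<bar>x\<bar> \<Longrightarrow> t x = 0"
    and t1: "\<bar>x\<bar> \<le> r \<Longrightarrow> t x = 1" for x
    by (auto simp: t_def)
  define h where "h n x = max 0 (min b (g n x))" for n x
  \<comment> \<open>Clamping, symmetrising and cutting off supply the hypotheses of the continuous
    case. They leave the limit unchanged, since \<open>v\<close> already has values between 0 and
    \<open>b\<close>, is even, and vanishes outside radius \<open>r\<close>.\<close>
  define u where "u n x = (h n x + h n (- x)) / 2 * t x" for n x
  have h: "0 \<le> h n x" "h n x \<le> b" for n x using b by (auto simp: h_def)
  have u_nonneg: "0 \<le> u n x" for n x using h t unfolding u_def by simp
  have u_le: "u n x \<le> b * indicator {-(r + 1)..r + 1} x" for n x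
  proof (cases "r + 1 < \<bar>x\<bar>")
    case False
    have "u n x \<le> b * 1"
      unfolding u_def using h[of n x] h[of n "-x"] t[of x] b by (intro mult_mono) auto
    then show ?thesis using False by (auto simp: indicator_def)
  qed (use b in \<open>simp add: u_def t0\<close>)
  have u_le_b: "u n x \<le> b" for n x
  proof -
    have "b * indicator {-(r + 1)..r + 1} x \<le> b * 1"
      using b by (intro mult_left_mono) (auto simp: indicator_def)
    then show ?thesis using u_le[of n x] by simp
  qed
  have u_cont: "continuous_on UNIV (u n)" for n
    unfolding u_def h_def t_def using g[of n]
    by (intro continuous_intros continuous_on_compose2[OF g]) auto
  have [measurable]: "u n \<in> borel_measurable borel" for n
    using u_cont by (rule borel_measurable_continuous_onI)
  have w: "integrable lborel (\<lambda>x. b * indicator {-(r + 1)..r + 1} x)"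
    by (intro integrable_mult_right integrable_real_indicator) (auto simp: emeasure_lborel_Icc_eq)
  have u_int: "integrable lborel (u n)" for n
    by (rule Bochner_Integration.integrable_bound[OF w])
       (use u_nonneg u_le in \<open>auto intro!: AE_I2 intro: order_trans[OF _ abs_ge_self]\<close>)
  have u_even: "u n (- x) = u n x" for n x by (simp add: u_def t add.commute)
  have u_lim: "AE x in lborel. (\<lambda>n. u n x) \<longlonglongrightarrow> v x"
    using ae ae'
  proof eventually_elim
    fix x assume lims: "(\<lambda>n. g n x) \<longlonglongrightarrow> v x" "(\<lambda>n. g n (- x)) \<longlonglongrightarrow> v x"
    have "(\<lambda>n. u n x) \<longlonglongrightarrow> (max 0 (min b (v x)) + max 0 (min b (v x))) / 2 * t x"
      unfolding u_def h_def by (intro tendsto_intros lims) auto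
    moreover have "(max 0 (min b (v x)) + max 0 (min b (v x))) / 2 * t x = v x"
      using bound[of x] supp[of x] t1[of x] by (cases "r < \<bar>x\<bar>") auto
    ultimately show "(\<lambda>n. u n x) \<longlonglongrightarrow> v x" by simp
  qed
  have "(\<lambda>n. LINT x|lborel. u n x * (l / (l\<^sup>2 + x\<^sup>2))) \<longlonglongrightarrow> (LINT x|lborel. v x * (l / (l\<^sup>2 + x\<^sup>2)))"
  proof (rule integral_dominated_convergence[OF _ _ w])
    show "AE x in lborel. (\<lambda>n. u n x * (l / (l\<^sup>2 + x\<^sup>2))) \<longlonglongrightarrow> v x * (l / (l\<^sup>2 + x\<^sup>2))"
      using u_lim by eventually_elim (intro tendsto_intros)
    show "AE x in lborel. norm (u n x * (l / (l\<^sup>2 + x\<^sup>2))) \<le> b * indicator {-(r + 1)..r + 1} x" for n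
      by (intro AE_I2 order_trans[OF _ u_le[of n]])
         (simp only: real_norm_def abs_mult abs_of_nonneg[OF u_nonneg] abs_of_nonneg[OF Poisson_kernel_nonneg]
           mult_left_le[OF Poisson_kernel_le u_nonneg])
  qed measurable
  then have "(\<lambda>n. 2 * pi * (exp ((LINT x|lborel. u n x * (l / (l\<^sup>2 + x\<^sup>2))) / (2 * pi)) * moment)\<^sup>2)
    \<longlonglongrightarrow> 2 * pi * (exp ((LINT x|lborel. v x * (l / (l\<^sup>2 + x\<^sup>2))) / (2 * pi)) * moment)\<^sup>2"
    by (intro tendsto_intros) auto
  moreover have "(\<lambda>n. LINT \<xi>|lborel. exp (u n \<xi>) * spectral_weight \<xi>)
    \<longlonglongrightarrow> (LINT \<xi>|lborel. exp (v \<xi>) * spectral_weight \<xi>)"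
  proof (rule integral_dominated_convergence)
    show "integrable lborel (\<lambda>\<xi>. exp b * spectral_weight \<xi>)"
      by (intro integrable_mult_right integrable_spectral_weight)
    show "AE \<xi> in lborel. (\<lambda>n. exp (u n \<xi>) * spectral_weight \<xi>) \<longlonglongrightarrow> exp (v \<xi>) * spectral_weight \<xi>"
      using u_lim by eventually_elim (intro tendsto_intros)
    show "AE \<xi> in lborel. norm (exp (u n \<xi>) * spectral_weight \<xi>) \<le> exp b * spectral_weight \<xi>" for n
      using u_le_b by (intro AE_I2) (simp add: abs_mult spectral_weight_nonneg mult_right_mono)
  qed measurable
  then have "(\<lambda>n. M * (LINT \<xi>|lborel. exp (u n \<xi>) * spectral_weight \<xi>))
    \<longlonglongrightarrow> M * (LINT \<xi>|lborel. exp (v \<xi>) * spectral_weight \<xi>)"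
    by (intro tendsto_intros)
  ultimately show ?thesis
  proof (rule LIMSEQ_le)
    have "\<bar>u n x\<bar> \<le> b" for n x using u_nonneg[of n x] u_le_b[of n x] by simp
    then show "\<exists>N. \<forall>n\<ge>N. 2 * pi * (exp ((LINT x|lborel. u n x * (l / (l\<^sup>2 + x\<^sup>2))) / (2 * pi)) * moment)\<^sup>2
        \<le> M * (LINT \<xi>|lborel. exp (u n \<xi>) * spectral_weight \<xi>)"
      using weighted_bound_continuous[OF u_cont u_int u_even] by blast
  qed
qed

text \<open>For truncations of \<open>w\<close> the right side has a bound independent of the
  truncation. A nonzero moment would then bound their Poisson integrals, and by Fatou that of
  \<open>w\<close>, contrary to divergence.\<close>

lemma moment_eq_zero:
  assumes w[measurable]: "w \<in> borel_measurable borel" and C: "0 \<le> C"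
    and decay: "AE \<xi> in lborel. cosine_transform \<Phi> \<xi> \<le> C * exp (- w \<xi>)"
    and w_nonneg: "\<And>\<xi>. 0 \<le> w \<xi>" and w_even: "\<And>\<xi>. w (- \<xi>) = w \<xi>"
    and diverges: "(\<integral>\<^sup>+ \<xi>. ennreal (w \<xi> / (1 + \<xi>\<^sup>2)) \<partial>lborel) = \<infinity>"
  shows "moment = 0"
proof (rule ccontr)
  assume "moment \<noteq> 0"
  note [measurable] = borel_measurable_spectral_weight
  define v where "v n x = min (w x) (real n) * indicator {- real n..real n} x" for n x
  have v[measurable]: "v n \<in> borel_measurable borel" for n unfolding v_def by measurable
  have v_nonneg: "0 \<le> v n x" and v_le_w: "v n x \<le> w x" and v_le: "v n x \<le> real n" for n x
    using w_nonneg[of x] by (auto simp: v_def indicator_def)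
  have v_even: "v n (- x) = v n x" for n x
    by (auto simp: v_def indicator_def w_even)
  define I where "I n = (LINT x|lborel. v n x * (l / (l\<^sup>2 + x\<^sup>2)))" for n
  define D where "D = M * (LINT \<xi>|lborel. C * (1 / (l\<^sup>2 + \<xi>\<^sup>2)))"
  have upper: "2 * pi * (exp (I n / (2 * pi)) * moment)\<^sup>2 \<le> D" for n
  proof -
    have int: "integrable lborel (\<lambda>\<xi>. exp (v n \<xi>) * spectral_weight \<xi>)"
      using integrable_mult_bounded[OF integrable_spectral_weight, of "\<lambda>\<xi>. exp (v n \<xi>)" "exp (real n)"] v_le
      by (simp add: mult.commute)
    have "2 * pi * (exp (I n / (2 * pi)) * moment)\<^sup>2 \<le> M * (LINT \<xi>|lborel. exp (v n \<xi>) * spectral_weight \<xi>)"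
      unfolding I_def
      by (rule weighted_bound_measurable[where b = "real n" and r = "real n"])
         (auto simp: v_nonneg v_even v_le, auto simp: v_def indicator_def)
    also have "\<dots> \<le> D"
      unfolding D_def
    proof (intro mult_left_mono bound_nonneg integral_mono_AE int)
      show "integrable lborel (\<lambda>\<xi>. C * (1 / (l\<^sup>2 + \<xi>\<^sup>2)))"
        by (intro integrable_mult_right integrable_inverse_square_plus rate)
      show "AE \<xi> in lborel. exp (v n \<xi>) * spectral_weight \<xi> \<le> C * (1 / (l\<^sup>2 + \<xi>\<^sup>2))"
        using decay
      proof eventually_elim
        fix \<xi> assume "cosine_transform \<Phi> \<xi> \<le> C * exp (- w \<xi>)"
        then have "max 0 (cosine_transform \<Phi> \<xi>) \<le> C * exp (- w \<xi>)" using C by simp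
        then have "exp (v n \<xi>) * max 0 (cosine_transform \<Phi> \<xi>) \<le> exp (w \<xi>) * (C * exp (- w \<xi>))"
          using v_le_w by (intro mult_mono) auto
        also have "\<dots> = C" by (simp add: exp_minus)
        finally show "exp (v n \<xi>) * spectral_weight \<xi> \<le> C * (1 / (l\<^sup>2 + \<xi>\<^sup>2))"
          using denominator_pos[of \<xi>] by (simp add: spectral_weight_def divide_right_mono)
      qed
    qed
    finally show ?thesis .
  qed
  \<comment> \<open>This is the upper estimate solved for \<open>exp (I n / pi)\<close>; squaring
    has turned the 2 pi of the exponent into pi.\<close>
  define E where "E = D / (2 * pi * moment\<^sup>2)"
  have I_le: "I n \<le> pi * E" for n
  proof -
    have "exp (I n / pi) \<le> E"
    proof -
      have "(exp (I n / (2 * pi)))\<^sup>2 = exp (I n / pi)"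
        by (simp add: power2_eq_square flip: exp_add)
      then have "exp (I n / pi) * (2 * pi * moment\<^sup>2) \<le> D"
        using upper[of n] by (simp add: power_mult_distrib mult_ac)
      then show ?thesis
        unfolding E_def using \<open>moment \<noteq> 0\<close> by (subst pos_le_divide_eq) auto
    qed
    \<comment> \<open>Any bound on the integrals independent of \<open>n\<close> will do, so this
      crude inequality replaces a logarithm.\<close>
    moreover have "I n / pi \<le> exp (I n / pi)"
      using exp_ge_add_one_self[of "I n / pi"] by linarith
    ultimately have "I n / pi \<le> E" by linarith
    then show ?thesis by (simp add: divide_le_eq mult.commute)
  qed
  have int: "integrable lborel (\<lambda>x. v n x * (l / (l\<^sup>2 + x\<^sup>2)))" for n
  proof (rule Bochner_Integration.integrable_bound)
    show "integrable lborel (\<lambda>x. real n * indicator {- real n..real n} x)"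
      by (intro integrable_mult_right integrable_real_indicator) (auto simp: emeasure_lborel_Icc_eq)
    have "v n x * (l / (l\<^sup>2 + x\<^sup>2)) \<le> real n * indicator {- real n..real n} x" for x
      by (rule order_trans[OF mult_left_le[OF Poisson_kernel_le v_nonneg]])
         (auto simp: v_def indicator_def)
    then show "AE x in lborel. norm (v n x * (l / (l\<^sup>2 + x\<^sup>2)))
        \<le> norm (real n * indicator {- real n..real n} x)"
      using v_nonneg Poisson_kernel_nonneg
      by (intro AE_I2) (simp only: real_norm_def abs_mult abs_of_nonneg abs_of_nat abs_indicator)
  qed measurable
  have "(\<integral>\<^sup>+ x. ennreal (w x * (l / (l\<^sup>2 + x\<^sup>2))) \<partial>lborel) \<le> ennreal (pi * E)"
  proof -
    have "(\<integral>\<^sup>+ x. ennreal (w x * (l / (l\<^sup>2 + x\<^sup>2))) \<partial>lborel)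
        = (\<integral>\<^sup>+ x. liminf (\<lambda>n. ennreal (v n x * (l / (l\<^sup>2 + x\<^sup>2)))) \<partial>lborel)"
    proof (intro nn_integral_cong)
      fix x
      \<comment> \<open>Beyond both \<open>w x\<close> and \<open>\<bar>x\<bar>\<close> the
        truncation is inactive at \<open>x\<close>, so the liminf in Fatou's lemma is the
        untruncated integrand.\<close>
      obtain m :: nat where m: "max (w x) \<bar>x\<bar> \<le> real m" using real_arch_simple by blast
      have "v n x = w x" if "m \<le> n" for n
        using m that by (auto simp: v_def indicator_def min_def)
      then have "eventually (\<lambda>n. ennreal (v n x * (l / (l\<^sup>2 + x\<^sup>2))) = ennreal (w x * (l / (l\<^sup>2 + x\<^sup>2)))) sequentially"
        by (auto simp: eventually_sequentially intro!: exI[of _ m])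
      then have "(\<lambda>n. ennreal (v n x * (l / (l\<^sup>2 + x\<^sup>2)))) \<longlonglongrightarrow> ennreal (w x * (l / (l\<^sup>2 + x\<^sup>2)))"
        by (rule tendsto_eventually)
      then show "ennreal (w x * (l / (l\<^sup>2 + x\<^sup>2))) = liminf (\<lambda>n. ennreal (v n x * (l / (l\<^sup>2 + x\<^sup>2))))"
        by (rule lim_imp_Liminf[OF trivial_limit_sequentially, symmetric])
    qed
    also have "\<dots> \<le> liminf (\<lambda>n. \<integral>\<^sup>+ x. ennreal (v n x * (l / (l\<^sup>2 + x\<^sup>2))) \<partial>lborel)"
      by (rule nn_integral_liminf) measurable
    also have "\<dots> = liminf (\<lambda>n. ennreal (I n))"
      unfolding I_def
      by (subst nn_integral_eq_integral[OF int AE_I2[OF mult_nonneg_nonneg[OF v_nonneg Poisson_kernel_nonneg]]]) (rule refl)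
    also have "\<dots> \<le> ennreal (pi * E)"
      using I_le by (intro Liminf_le) (auto intro!: always_eventually ennreal_leI)
    finally show ?thesis .
  qed
  moreover have "(\<integral>\<^sup>+ x. ennreal (w x / (1 + x\<^sup>2)) \<partial>lborel) \<le> (\<integral>\<^sup>+ x. ennreal l * ennreal (w x * (l / (l\<^sup>2 + x\<^sup>2))) \<partial>lborel)"
  proof (intro nn_integral_mono)
    fix x
    have "1 \<le> l\<^sup>2" using rate by (simp add: one_le_power)
    \<comment> \<open>This compares the kernel of the hypothesis with the Poisson kernel of rate
      \<open>l\<close>, at the cost of a factor \<open>l\<close>.\<close>
    then have "l\<^sup>2 + x\<^sup>2 \<le> l\<^sup>2 * (1 + x\<^sup>2)"
      using mult_right_mono[of 1 "l\<^sup>2" "x\<^sup>2"] by (simp add: distrib_left)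
    then have "1 / (1 + x\<^sup>2) \<le> l\<^sup>2 / (l\<^sup>2 + x\<^sup>2)"
      using denominator_pos[of x] by (simp add: frac_le_eq field_simps add_pos_nonneg)
    then have "w x * (1 / (1 + x\<^sup>2)) \<le> w x * (l\<^sup>2 / (l\<^sup>2 + x\<^sup>2))"
      using w_nonneg by (rule mult_left_mono)
    then show "ennreal (w x / (1 + x\<^sup>2)) \<le> ennreal l * ennreal (w x * (l / (l\<^sup>2 + x\<^sup>2)))"
      using rate_pos by (simp add: ennreal_mult'[symmetric] power2_eq_square ennreal_leI mult_ac)
  qed
  then have "(\<integral>\<^sup>+ x. ennreal (w x / (1 + x\<^sup>2)) \<partial>lborel) \<le> ennreal l * (\<integral>\<^sup>+ x. ennreal (w x * (l / (l\<^sup>2 + x\<^sup>2))) \<partial>lborel)"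
    by (subst (asm) nn_integral_cmult) measurable
  ultimately have "\<infinity> \<le> ennreal l * ennreal (pi * E)"
    unfolding diverges by (meson mult_left_mono order_trans zero_le)
  then show False
    by (simp add: ennreal_mult_eq_top_iff top.extremum_unique)
qed

end

subsection \<open>Vanishing moments and the reproducing kernel Hilbert space\<close>

text \<open>With t = e^x the hypotheses say that \<open>f\<close> is orthogonal, for the weight e^x,
  to all polynomials in t. Approximating t f(ln t) uniformly by such a polynomial shows that the
  integral of e^(2x) f^2 is arbitrarily small.\<close>

lemma (in kernel_dominated) eq_zero_if_moments_vanish:
  assumes vanishing: "\<And>x. 0 \<le> x \<Longrightarrow> f x = 0"
    and moments: "\<And>n. 1 \<le> n \<Longrightarrow> (LINT x|lborel. (indicator {..<0} x * exp (real n * x)) * f x) = 0"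
  shows "f = (\<lambda>x. 0)"
proof -
  note [measurable] = borel_measurable
  define B where "B = sqrt (M * \<Phi> 0)"
  have B: "\<bar>f x\<bar> \<le> B" for x unfolding B_def by (rule bounded)
  then have B0: "0 \<le> B" using abs_ge_zero order_trans by blast
  have contf: "isCont f x" for x
    using continuous by (simp add: continuous_on_eq_continuous_at)
  define e where "e n x = indicator {..<0} x * exp (real n * x)" for n and x :: real
  have e_int: "integrable lborel (e n)" if "1 \<le> n" for n
  proof -
    have "integrable lborel (\<lambda>x. indicator {0<..} (0 + - 1 * x) * exp (- (real n * (0 + - 1 * x))))"
      using that by (intro lborel_integrable_real_affine integrable_one_sided_exponential) auto
    also have "(\<lambda>x. indicator {0<..} (0 + - 1 * x) * exp (- (real n * (0 + - 1 * x)))) = e n"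
      by (auto simp: e_def indicator_def)
    finally show ?thesis .
  qed
  have ef_int: "integrable lborel (\<lambda>x. e n x * f x)" if "1 \<le> n" for n
    by (rule integrable_mult_bounded[OF e_int[OF that], of f B]) (use B in auto)
  \<comment> \<open>The factor \<open>t\<close> forces the limit 0 at \<open>t = 0\<close>, where
    \<open>f (ln t)\<close> alone need not converge.\<close>
  define g where "g t = t * f (ln t)" for t :: real
  have g_cont: "continuous_on {0..1} g"
  proof (rule continuous_at_imp_continuous_on, rule ballI)
    fix t :: real assume "t \<in> {0..1}"
    show "isCont g t"
    proof (cases "t = 0")
      case True
      have "(g \<longlongrightarrow> 0) (at 0)"
      proof (rule tendsto_rabs_zero_cancel, rule tendsto_sandwich[where f = "\<lambda>_. 0" and h = "\<lambda>t. \<bar>t\<bar> * B"])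
        \<comment> \<open>The limit is two-sided; for negative \<open>t\<close> the estimate holds
          whatever value \<open>ln t\<close> takes, because \<open>f\<close> is bounded.\<close>
        show "\<forall>\<^sub>F t in at 0. \<bar>g t\<bar> \<le> \<bar>t\<bar> * B"
          using B by (auto simp: g_def abs_mult intro!: always_eventually mult_left_mono)
        show "((\<lambda>t. \<bar>t\<bar> * B) \<longlongrightarrow> 0) (at 0)" by (auto intro!: tendsto_eq_intros)
      qed auto
      then show ?thesis by (simp add: isCont_def True g_def)
    next
      case False
      then show ?thesis
        unfolding g_def by (intro continuous_intros isCont_o2[OF _ contf]) auto
    qed
  qed
  define J where "J = (LINT x|lborel. e 2 x * (f x)\<^sup>2)"
  have J_int: "integrable lborel (\<lambda>x. e 2 x * (f x)\<^sup>2)"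
  proof (rule integrable_mult_bounded[OF e_int])
    show "norm ((f x)\<^sup>2) \<le> B\<^sup>2" for x using power_mono[OF B, of x 2] by simp
  qed auto
  have J_le: "\<bar>J\<bar> \<le> \<delta> * (LINT x|lborel. e 1 x * B)" if \<delta>: "0 < \<delta>" for \<delta>
  proof -
    obtain q where "real_polynomial_function q" and q: "\<And>t. t \<in> {0..1} \<Longrightarrow> \<bar>g t - q t\<bar> < \<delta>"
      using Stone_Weierstrass_real_polynomial_function[OF compact_Icc g_cont \<delta>] by metis
    then obtain a m where q_eq: "q = (\<lambda>t. \<Sum>i\<le>m. a i * t ^ i)"
      by (auto simp: real_polynomial_function_iff_sum)
    have approx: "\<bar>exp x * f x - q (exp x)\<bar> \<le> \<delta>" if "x < 0" for x
      using q[of "exp x"] that by (simp add: g_def)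
    have e_Suc: "e 1 x * exp x ^ i = e (Suc i) x" for i x
      by (simp add: e_def exp_of_nat_mult[symmetric] algebra_simps flip: exp_add)
    have eq: "e 1 x * f x * q (exp x) = (\<Sum>i\<le>m. a i * (e (Suc i) x * f x))" for x
      unfolding q_eq sum_distrib_left e_Suc[symmetric] by (simp add: mult_ac)
    have q_int: "integrable lborel (\<lambda>x. e 1 x * f x * q (exp x))"
      unfolding eq by (intro Bochner_Integration.integrable_sum integrable_mult_right ef_int) simp
    have "(LINT x|lborel. e 1 x * f x * q (exp x)) = 0"
    proof -
      have "(LINT x|lborel. e (Suc i) x * f x) = 0" for i
        using moments[of "Suc i"] by (simp only: e_def)
      then show ?thesis
        unfolding eq
        by (subst Bochner_Integration.integral_sum) (auto intro!: integrable_mult_right ef_int)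
    qed
    then have "J = (LINT x|lborel. e 2 x * (f x)\<^sup>2) - (LINT x|lborel. e 1 x * f x * q (exp x))"
      by (simp add: J_def)
    also have "\<dots> = (LINT x|lborel. e 2 x * (f x)\<^sup>2 - e 1 x * f x * q (exp x))"
      by (rule Bochner_Integration.integral_diff[symmetric, OF J_int q_int])
    also have "\<bar>\<dots>\<bar> \<le> (LINT x|lborel. \<delta> * (e 1 x * B))"
    proof (rule Bochner_Integration.integral_abs_bound_integral)
      show "integrable lborel (\<lambda>x. e 2 x * (f x)\<^sup>2 - e 1 x * f x * q (exp x))"
        by (intro Bochner_Integration.integrable_diff J_int q_int)
      show "integrable lborel (\<lambda>x. \<delta> * (e 1 x * B))"
        using e_int[of 1] by simp
      show "\<bar>e 2 x * (f x)\<^sup>2 - e 1 x * f x * q (exp x)\<bar> \<le> \<delta> * (e 1 x * B)" for x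
      proof (cases "x < 0")
        case True
        have "e 2 x * (f x)\<^sup>2 - e 1 x * f x * q (exp x) = (exp x * f x) * (exp x * f x - q (exp x))"
          using True by (simp add: e_def power2_eq_square algebra_simps flip: exp_add)
        also have "\<bar>\<dots>\<bar> \<le> (exp x * B) * \<delta>"
          unfolding abs_mult by (intro mult_mono approx True B) (auto simp: B0)
        finally show ?thesis using True by (simp add: e_def mult_ac)
      qed (simp add: e_def)
    qed
    finally show ?thesis by simp
  qed
  have "\<bar>J\<bar> \<le> 0"
  proof (rule field_le_epsilon)
    fix \<epsilon> :: real assume "0 < \<epsilon>"
    define I where "I = (LINT x|lborel. e 1 x * B)"
    have I0: "0 \<le> I"
      unfolding I_def using B0 by (intro Bochner_Integration.integral_nonneg) (simp add: e_def)
    \<comment> \<open>Adding 1 keeps the denominator positive even if \<open>I\<close> is 0.\<close>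
    have "\<bar>J\<bar> \<le> \<epsilon> / (I + 1) * I"
      using J_le[of "\<epsilon> / (I + 1)"] \<open>0 < \<epsilon>\<close> I0 by (simp add: I_def)
    also have "\<dots> \<le> \<epsilon>" using \<open>0 < \<epsilon>\<close> I0 by (simp add: divide_le_eq)
    finally show "\<bar>J\<bar> \<le> 0 + \<epsilon>" by simp
  qed
  then have "J = 0" by simp
  moreover have "AE x in lborel. 0 \<le> e 2 x * (f x)\<^sup>2"
    by (simp add: e_def)
  ultimately have "AE x in lborel. e 2 x * (f x)\<^sup>2 = 0"
    using integral_nonneg_eq_0_iff_AE[OF J_int] unfolding J_def by blast
  then have ae: "AE x in lborel. x \<notin> {x. x < 0 \<and> f x \<noteq> 0}"
    by eventually_elim (auto simp: e_def)
  \<comment> \<open>A nonempty open set has positive measure, which upgrades vanishing almost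
    everywhere to vanishing everywhere.\<close>
  have op: "open {x. x < 0 \<and> f x \<noteq> 0}"
    using continuous by (intro open_Collect_conj open_Collect_less open_Collect_neq continuous_intros)
  then have "{x. x < 0 \<and> f x \<noteq> 0} \<in> null_sets lborel"
    by (subst AE_iff_null_sets) (use ae in auto)
  then have "negligible {x. x < 0 \<and> f x \<noteq> 0}"
    by (simp add: negligible_iff_null_sets null_sets_completionI)
  then have "{x. x < 0 \<and> f x \<noteq> 0} = {}"
    using op open_not_negligible by blast
  then show ?thesis using vanishing by (metis (mono_tags, lifting) Collect_empty_eq linorder_not_le)
qed

text \<open>Each coefficient \<open>c a\<close> is moved to the point \<open>\<sigma> a\<close>,
  which leaves the quadratic form unchanged. Translations and reflections are the two cases applied
  at the end.\<close>

lemma (in kernel_dominated) isometry: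
  assumes inj: "inj \<sigma>" and iso: "\<And>x y. \<Phi> (\<sigma> x - \<sigma> y) = \<Phi> (x - y)"
  shows "kernel_dominated \<Phi> (\<lambda>x. f (\<sigma> x)) M"
proof
  fix A :: "real set" and c :: "real \<Rightarrow> real" assume "finite A"
  have i: "inj_on \<sigma> A" using inj by (rule inj_on_subset) simp
  show "(\<Sum>a\<in>A. c a * f (\<sigma> a))\<^sup>2 \<le> M * (\<Sum>a\<in>A. \<Sum>b\<in>A. c a * c b * \<Phi> (a - b))"
    using dominated[of "\<sigma> ` A" "\<lambda>b. c (inv \<sigma> b)"] \<open>finite A\<close>
    by (simp add: sum.reindex[OF i] inv_f_f[OF inj] iso)
qed (fact kernel_continuous kernel_integrable kernel_even kernel_bounded bound_nonneg)+

section \<open>Cauchy-Schwarz and finite kernel combinations in the Hilbert space\<close>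

context hilbert_function_space
begin

lemma ip_zero_left:
  assumes "h \<in> H"
  shows "ip (\<lambda>x. 0) h = 0"
  using ip_scale_left[OF zero_mem assms, of 0] by simp

lemma ip_add_right: "\<lbrakk>f \<in> H; g \<in> H; h \<in> H\<rbrakk> \<Longrightarrow> ip h (\<lambda>x. f x + g x) = ip h f + ip h g"
  using ip_add_left[of f g h] by (simp add: ip_commute add_mem)

lemma ip_scale_right: "\<lbrakk>f \<in> H; g \<in> H\<rbrakk> \<Longrightarrow> ip g (\<lambda>x. r * f x) = r * ip g f"
  using ip_scale_left[of f g r] by (simp add: ip_commute scale_mem)

lemma Cauchy_Schwarz:
  assumes f: "f \<in> H" and g: "g \<in> H"
  shows "(ip f g)\<^sup>2 \<le> ip f f * ip g g"
proof (cases "ip g g = 0")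
  case True
  then have "g = (\<lambda>x. 0)" using ip_eq_zero g by blast
  then show ?thesis using ip_zero_left[OF f] ip_commute[OF f g] True by simp
next
  case False
  then have pos: "0 < ip g g" using ip_nonneg[OF g] by simp
  \<comment> \<open>The minimiser of the squared norm of f + t g.\<close>
  define t where "t = - (ip f g / ip g g)"
  let ?h = "\<lambda>x. t * g x"
  have h: "?h \<in> H" by (rule scale_mem[OF g])
  have "0 \<le> ip (\<lambda>x. f x + ?h x) (\<lambda>x. f x + ?h x)"
    by (rule ip_nonneg[OF add_mem[OF f h]])
  also have "\<dots> = ip f f + 2 * (t * ip f g) + t * (t * ip g g)"
    using f g h by (simp add: ip_add_left ip_add_right add_mem ip_scale_left ip_scale_right ip_commute[OF g f])
  also have "\<dots> = ip f f - (ip f g)\<^sup>2 / ip g g"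
    using pos by (simp add: t_def power2_eq_square)
  finally show ?thesis using pos by (simp add: pos_divide_le_eq)
qed

end

context reproducing_kernel_hilbert_space
begin

text \<open>Both claims go through one induction, since additivity of \<open>ip\<close> requires
  membership. With \<open>h\<close> arbitrary in \<open>H\<close>, the formula also evaluates the
  squared norm of the combination itself.\<close>

lemma kernel_combination:
  assumes "finite A"
  shows kernel_combination_mem: "(\<lambda>y. \<Sum>a\<in>A. c a * K y a) \<in> H"
    and ip_kernel_combination: "h \<in> H \<Longrightarrow> ip (\<lambda>y. \<Sum>a\<in>A. c a * K y a) h = (\<Sum>a\<in>A. c a * h a)"
proof -
  have "(\<lambda>y. \<Sum>a\<in>A. c a * K y a) \<in> H
      \<and> (\<forall>h\<in>H. ip (\<lambda>y. \<Sum>a\<in>A. c a * K y a) h = (\<Sum>a\<in>A. c a * h a))"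
    using assms
  proof (induction A rule: finite_induct)
    case empty
    show ?case by (simp add: zero_mem ip_zero_left)
  next
    case (insert a A)
    have k: "(\<lambda>y. c a * K y a) \<in> H" by (rule scale_mem[OF kernel_mem])
    have "ip (\<lambda>y. c a * K y a) h = c a * h a" if "h \<in> H" for h
      using that by (simp add: ip_scale_left[OF kernel_mem] ip_commute[OF kernel_mem] reproducing)
    then show ?case
      using insert k by (simp add: add_mem ip_add_left)
  qed
  then show "(\<lambda>y. \<Sum>a\<in>A. c a * K y a) \<in> H"
    and "h \<in> H \<Longrightarrow> ip (\<lambda>y. \<Sum>a\<in>A. c a * K y a) h = (\<Sum>a\<in>A. c a * h a)"
    by blast+
qed

lemma kernel_domination:
  assumes f: "f \<in> H" and A: "finite A"
  shows "(\<Sum>a\<in>A. c a * f a)\<^sup>2 \<le> ip f f * (\<Sum>a\<in>A. \<Sum>b\<in>A. c a * c b * K a b)"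
proof -
  let ?g = "\<lambda>y. \<Sum>a\<in>A. c a * K y a"
  have g: "?g \<in> H" by (rule kernel_combination_mem[OF A])
  have "(ip ?g f)\<^sup>2 \<le> ip ?g ?g * ip f f" by (rule Cauchy_Schwarz[OF g f])
  then show ?thesis
    unfolding ip_kernel_combination[OF A f] ip_kernel_combination[OF A g]
    by (simp add: sum_distrib_left mult_ac)
qed

end

section \<open>From the hypotheses of the theorem to the dominated setting\<close>

lemma positive_definite_functionD:
  assumes "positive_definite_function \<Phi>"
  shows positive_definite_function_even: "\<Phi> (- x) = \<Phi> x"
    and positive_definite_function_bounded: "\<bar>\<Phi> x\<bar> \<le> \<Phi> 0"
proof -
  have even: "\<Phi> (- x) = \<Phi> x" for x
    using assms[unfolded positive_definite_function_def, THEN conjunct1, rule_format, of 0 x] by simp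
  show "\<Phi> (- x) = \<Phi> x" by (rule even)
  have pd: "0 < (\<Sum>i<n. \<Sum>j<n. c i * c j * \<Phi> (y i - y j))"
    if "inj_on y {..<n}" "\<exists>i<n. c i \<noteq> 0" for n :: nat and y c :: "nat \<Rightarrow> real"
    using assms that unfolding positive_definite_function_def by blast
  \<comment> \<open>Positive definiteness is tested on the points 0 and \<open>x\<close> with
    coefficients 1 and \<open>s\<close>; the signs 1 and -1 give the two halves of the
    bound.\<close>
  have "0 < 2 * \<Phi> 0 + 2 * s * \<Phi> x" if "x \<noteq> 0" "s * s = 1" for s
  proof -
    have "0 < (\<Sum>i<2::nat. \<Sum>j<2::nat. (if i = 0 then 1 else s) * (if j = 0 then 1 else s)
        * \<Phi> ((if i = 0 then 0 else x) - (if j = 0 then 0 else x)))"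
      using that by (intro pd) (auto simp: inj_on_def less_2_cases_iff)
    moreover have "s * (s * \<Phi> 0) = \<Phi> 0" using that by (simp flip: mult.assoc)
    ultimately show ?thesis using that by (simp add: numeral_2_eq_2 even algebra_simps)
  qed
  from this[of 1] this[of "- 1"] have "\<bar>\<Phi> x\<bar> \<le> \<Phi> 0" if "x \<noteq> 0"
    using that by simp
  moreover have "0 < \<Phi> 0"
    using pd[of "\<lambda>_. 0" 1 "\<lambda>_. 1"] by (simp add: inj_on_def)
  ultimately show "\<bar>\<Phi> x\<bar> \<le> \<Phi> 0" by (cases "x = 0") auto
qed

lemma Re_fourier_transform:
  assumes meas: "\<Phi> \<in> borel_measurable borel" and int: "integrable lborel \<Phi>"
  shows "Re (fourier_transform \<Phi> \<xi>) = cosine_transform \<Phi> \<xi> / sqrt (2 * pi)"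
proof -
  note [measurable] = meas
  have eq: "complex_of_real (\<Phi> x) * exp (- (\<i> * complex_of_real (x * \<xi>))) = \<Phi> x *\<^sub>R cis (- (x * \<xi>))" for x
    by (simp add: cis_conv_exp scaleR_conv_of_real)
  have i: "integrable lborel (\<lambda>x. \<Phi> x *\<^sub>R cis (- (x * \<xi>)))"
    by (rule integrable_scaleR_bounded[OF int, of _ 1]) auto
  have "(LINT x|lebesgue. \<Phi> x *\<^sub>R cis (- (x * \<xi>))) = (LINT x|lborel. \<Phi> x *\<^sub>R cis (- (x * \<xi>)))"
    by (rule integral_completion) simp
  moreover have "Re (LINT x|lborel. \<Phi> x *\<^sub>R cis (- (x * \<xi>))) = cosine_transform \<Phi> \<xi>"
    using integral_Re[OF i] by (simp add: cosine_transform_def)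
  ultimately show ?thesis
    unfolding fourier_transform_def eq by simp
qed

lemma (in kernel_dominated) eq_zero_if_vanishing:
  assumes vanishing: "\<And>x. 0 \<le> x \<Longrightarrow> f x = 0"
    and w: "w \<in> borel_measurable borel" and C: "0 \<le> C"
    and decay: "AE \<xi> in lborel. cosine_transform \<Phi> \<xi> \<le> C * exp (- w \<xi>)"
    and w_nonneg: "\<And>\<xi>. 0 \<le> w \<xi>" and w_even: "\<And>\<xi>. w (- \<xi>) = w \<xi>"
    and diverges: "(\<integral>\<^sup>+ \<xi>. ennreal (w \<xi> / (1 + \<xi>\<^sup>2)) \<partial>lborel) = \<infinity>"
  shows "f = (\<lambda>x. 0)"
proof (rule eq_zero_if_moments_vanish[OF vanishing])
  fix n :: nat assume "1 \<le> n"
  then interpret vanishing_kernel_dominated \<Phi> f M "real n"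
    by unfold_locales (auto simp: vanishing)
  show "(LINT x|lborel. (indicator {..<0} x * exp (real n * x)) * f x) = 0"
    using moment_eq_zero[OF w C decay w_nonneg w_even diverges] by (simp only: moment_def)
qed

text \<open>The transform is even, so the decay also holds with the reflected exponent, hence with
  the larger of the two; enlarging the exponent preserves divergence. The passage to a Borel
  function is what turns the decay into a statement almost everywhere.\<close>

lemma even_spectral_decay:
  assumes \<Phi>: "\<Phi> \<in> borel_measurable borel" and \<omega>: "\<omega> \<in> borel_measurable lebesgue"
    and \<omega>_nonneg: "\<And>\<xi>. 0 \<le> \<omega> \<xi>" and C: "0 \<le> C"
    and decay: "\<And>\<xi>. cosine_transform \<Phi> \<xi> \<le> C * exp (- \<omega> \<xi>)"
    and diverges: "(\<integral>\<^sup>+ \<xi>. ennreal (\<omega> \<xi> / (1 + \<xi>\<^sup>2)) \<partial>lebesgue) = \<infinity>"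
  obtains w where "w \<in> borel_measurable borel"
    "AE \<xi> in lborel. cosine_transform \<Phi> \<xi> \<le> C * exp (- w \<xi>)"
    "\<And>\<xi>. 0 \<le> w \<xi>" "\<And>\<xi>. w (- \<xi>) = w \<xi>"
    "(\<integral>\<^sup>+ \<xi>. ennreal (w \<xi> / (1 + \<xi>\<^sup>2)) \<partial>lborel) = \<infinity>"
proof -
  obtain \<omega>' where \<omega>'[measurable]: "\<omega>' \<in> borel_measurable borel" and ae: "AE \<xi> in lborel. \<omega> \<xi> = \<omega>' \<xi>"
    using completion_ex_borel_measurable_real[OF \<omega>] by auto
  note [measurable] = \<Phi>
  \<comment> \<open>The Borel version of \<omega> may be negative on a null set; the outer maximum
    makes \<open>w\<close> nonnegative everywhere.\<close>
  define w where "w \<xi> = max 0 (max (\<omega>' \<xi>) (\<omega>' (- \<xi>)))" for \<xi>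
  have ae': "AE \<xi> in lborel. cosine_transform \<Phi> \<xi> \<le> C * exp (- \<omega>' \<xi>)"
    using ae by eventually_elim (use decay in metis)
  have "AE \<xi> in lborel. cosine_transform \<Phi> (0 + (- 1) * \<xi>) \<le> C * exp (- \<omega>' (0 + (- 1) * \<xi>))"
    by (rule AE_borel_affine[OF _ _ ae']) auto
  then have ae'': "AE \<xi> in lborel. cosine_transform \<Phi> \<xi> \<le> C * exp (- \<omega>' (- \<xi>))"
    by (simp add: cosine_transform_minus)
  show thesis
  proof (rule that)
    show "w \<in> borel_measurable borel" unfolding w_def by measurable
    show "AE \<xi> in lborel. cosine_transform \<Phi> \<xi> \<le> C * exp (- w \<xi>)"
      using ae' ae''
    proof eventually_elim
      fix \<xi>
      assume "cosine_transform \<Phi> \<xi> \<le> C * exp (- \<omega>' \<xi>)" "cosine_transform \<Phi> \<xi> \<le> C * exp (- \<omega>' (- \<xi>))"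
      \<comment> \<open>This covers the points where the maximum defining \<open>w\<close> is
        attained by 0.\<close>
      moreover have "cosine_transform \<Phi> \<xi> \<le> C * exp (- 0)"
        using decay[of \<xi>] C \<omega>_nonneg[of \<xi>] mult_left_mono[of "exp (- \<omega> \<xi>)" 1 C] by simp
      ultimately show "cosine_transform \<Phi> \<xi> \<le> C * exp (- w \<xi>)"
        unfolding w_def max_def by presburger
    qed
    show "0 \<le> w \<xi>" "w (- \<xi>) = w \<xi>" for \<xi>
      by (auto simp: w_def max.commute)
    have "(\<integral>\<^sup>+ \<xi>. ennreal (\<omega> \<xi> / (1 + \<xi>\<^sup>2)) \<partial>lborel) \<le> (\<integral>\<^sup>+ \<xi>. ennreal (w \<xi> / (1 + \<xi>\<^sup>2)) \<partial>lborel)"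
    proof (rule nn_integral_mono_AE)
      show "AE \<xi> in lborel. ennreal (\<omega> \<xi> / (1 + \<xi>\<^sup>2)) \<le> ennreal (w \<xi> / (1 + \<xi>\<^sup>2))"
        using ae by eventually_elim (auto simp: w_def intro!: ennreal_leI divide_right_mono)
    qed
    then show "(\<integral>\<^sup>+ \<xi>. ennreal (w \<xi> / (1 + \<xi>\<^sup>2)) \<partial>lborel) = \<infinity>"
      using diverges by (simp add: nn_integral_completion top.extremum_unique)
  qed
qed

theorem theorem2p1:
  fixes \<Phi> :: "real \<Rightarrow> real"
    and \<omega> :: "real \<Rightarrow> real"
    and H :: "(real \<Rightarrow> real) set"
    and ip :: "(real \<Rightarrow> real) \<Rightarrow> (real \<Rightarrow> real) \<Rightarrow> real"
    and f :: "real \<Rightarrow> real"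
  assumes "continuous_on UNIV \<Phi>"
    and "integrable lebesgue \<Phi>"
    and "positive_definite_function \<Phi>"
    and "reproducing_kernel_hilbert_space (\<lambda>x y. \<Phi> (x - y)) H ip"
    and "\<omega> \<in> borel_measurable lebesgue"
    and "\<And>\<xi>. 0 \<le> \<omega> \<xi>"
    and "\<exists>C>0. \<forall>\<xi>. Re (fourier_transform \<Phi> \<xi>) \<le> C * exp (- \<omega> \<xi>)"
    and "(\<integral>\<^sup>+ \<xi>. ennreal (\<omega> \<xi> / (1 + \<xi>\<^sup>2)) \<partial>lebesgue) = \<infinity>"
    and "f \<in> H"
    and "semibounded_support f"
  shows "f = (\<lambda>x. 0)"
proof -
  interpret R: reproducing_kernel_hilbert_space "\<lambda>x y. \<Phi> (x - y)" H ip by fact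
  have meas: "\<Phi> \<in> borel_measurable borel"
    using assms(1) by (rule borel_measurable_continuous_onI)
  have int: "integrable lborel \<Phi>"
    using assms(2) meas integrable_completion[of \<Phi> lborel] by simp
  have even: "\<Phi> (x - y) = \<Phi> (y - x)" for x y
    using positive_definite_function_even[OF assms(3), of "x - y"] by simp
  have dominated: "kernel_dominated \<Phi> f (ip f f)"
    using positive_definite_functionD[OF assms(3)] R.kernel_domination[OF assms(9)] R.ip_nonneg[OF assms(9)]
    by unfold_locales (auto intro: assms(1) int)
  obtain C where C: "0 < C" and decay: "\<And>\<xi>. Re (fourier_transform \<Phi> \<xi>) \<le> C * exp (- \<omega> \<xi>)"
    using assms(7) by blast
  have decay': "cosine_transform \<Phi> \<xi> \<le> (sqrt (2 * pi) * C) * exp (- \<omega> \<xi>)" for \<xi>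
    using decay[of \<xi>] by (simp add: Re_fourier_transform[OF meas int] divide_le_eq mult_ac)
  have C': "0 \<le> sqrt (2 * pi) * C" using C by simp
  obtain w where w: "w \<in> borel_measurable borel"
    "AE \<xi> in lborel. cosine_transform \<Phi> \<xi> \<le> (sqrt (2 * pi) * C) * exp (- w \<xi>)"
    "\<And>\<xi>. 0 \<le> w \<xi>" "\<And>\<xi>. w (- \<xi>) = w \<xi>"
    "(\<integral>\<^sup>+ \<xi>. ennreal (w \<xi> / (1 + \<xi>\<^sup>2)) \<partial>lborel) = \<infinity>"
    using even_spectral_decay[OF meas assms(5,6) C' decay' assms(8)] by blast
  \<comment> \<open>Translates and reflections of \<open>f\<close> keep the constant
    \<open>ip f f\<close>, so one statement with this constant serves both cases.\<close>
  have zero: "g = (\<lambda>x. 0)" if "kernel_dominated \<Phi> g (ip f f)" "\<And>x. 0 \<le> x \<Longrightarrow> g x = 0" for g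
    using kernel_dominated.eq_zero_if_vanishing[OF that w(1) C' w(2-5)] .
  have outside: "f x = 0" if "x \<notin> support f" for x
    using that closure_subset[of "{x. f x \<noteq> 0}"] by (auto simp: support_def)
  obtain a where a: "support f \<subseteq> {..a} \<or> support f \<subseteq> {a..}"
    using assms(10) unfolding semibounded_support_def by blast
  then show ?thesis
  proof
    assume "support f \<subseteq> {..a}"
    \<comment> \<open>Shifting by \<open>a + 1\<close> instead of \<open>a\<close> keeps every point
      strictly outside the support, including the one at \<open>x = 0\<close>.\<close>
    then have "f (a + 1 + x) = 0" if "0 \<le> x" for x
      using that by (intro outside) force
    moreover have "kernel_dominated \<Phi> (\<lambda>x. f (a + 1 + x)) (ip f f)"
      by (rule kernel_dominated.isometry[OF dominated]) (auto simp: inj_def)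
    ultimately have "f (a + 1 + x) = 0" for x
      using zero[of "\<lambda>x. f (a + 1 + x)"] by (auto dest: fun_cong)
    from this[of "x - (a + 1)" for x] show ?thesis by auto
  next
    assume "support f \<subseteq> {a..}"
    then have "f (a - 1 - x) = 0" if "0 \<le> x" for x
      using that by (intro outside) force
    moreover have "kernel_dominated \<Phi> (\<lambda>x. f (a - 1 - x)) (ip f f)"
      by (rule kernel_dominated.isometry[OF dominated]) (auto simp: inj_def even)
    ultimately have "f (a - 1 - x) = 0" for x
      using zero[of "\<lambda>x. f (a - 1 - x)"] by (auto dest: fun_cong)
    from this[of "a - 1 - x" for x] show ?thesis by auto
  qed
qed

end
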